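(* For every v-admissible triplet $(4,c,n)$ (with integers $4\le c\le n$), $A(4,c,n)=1$ if $c$ is even and $A(4,c,n)=5/4$ if $c$ is odd.
   Context: All graphs are finite, simple and connected. A graph $G$ is regarded as a geodesic metric space by identifying each edge isometrically with $[0,1]$; points are vertices and interior points of edges, $d$ is the shortest-path length. A geodesic triangle $T=\{x,y,z\}$ is a union of three geodesics $[xy],[yz],[zx]$; $\delta(T)$ is the infimum of $\delta\ge0$ such that each side lies in the $\delta$-neighbourhood of the union of the other two; $\delta(G)=\sup_T\delta(T)$ over geodesic triangles. Girth $g(G)$ / circumference $c(G)$: length of a shortest / longest cycle. $\mathcal{G}(g,c,n)$ is the set of graphs with girth $g$, circumference $c$ and $n$ vertices, and $A(g,c,n)=\min\{\delta(G):G\in\mathcal{G}(g,c,n)\}$. A triplet $(g,c,n)$ is v-admissible if $\mathcal{G}(g,c,n)\ne\emptyset$. *)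

theory Defs
  imports Complex_Main "HOL-Library.Extended_Nat" "Graph_Theory.Graph_Theory"
begin

text \<open>
  Finite simple graphs are the symmetric, loop-free, finite pair digraphs of \<open>Graph_Theory\<close>
  (\<^locale>\<open>pair_graph\<close>): an undirected edge is a pair of opposite arcs. Connectedness is the
  library notion; it excludes the graph without vertices.
\<close>

definition fin_simple_connected :: "'a pair_pre_digraph \<Rightarrow> bool" where
  "fin_simple_connected G \<longleftrightarrow> pair_graph G \<and> Digraph_Component.connected (with_proj G)"


section \<open>Girth and circumference\<close>

text \<open>
  A closed walk back and forth along one edge is a \<open>cycle\<close> of length 2 of the symmetric
  digraph, but not a cycle of the graph; all cycles of length at least 3 are genuine.
  A graph without cycles has girth \<open>\<infinity>\<close> and circumference \<open>0\<close>.
\<close>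

definition cycle_lengths :: "'a pair_pre_digraph \<Rightarrow> nat set" where
  "cycle_lengths G = {length p | p. pre_digraph.cycle (with_proj G) p \<and> 3 \<le> length p}"

definition girth :: "'a pair_pre_digraph \<Rightarrow> enat" where
  "girth G = (INF k\<in>cycle_lengths G. enat k)"

definition circumference :: "'a pair_pre_digraph \<Rightarrow> enat" where
  "circumference G = (SUP k\<in>cycle_lengths G. enat k)"


section \<open>A graph as a geodesic metric space\<close>

text \<open>
  Points are given by barycentric coordinates with respect to the vertices:
  \<open>edge_pt u v t\<close> is the point of the edge \<open>uv\<close> at distance \<open>t\<close> from \<open>u\<close>. Hence
  \<open>edge_pt u v t = edge_pt v u (1 - t)\<close>, \<open>edge_pt u v 0 = vertex_pt u\<close> and
  \<open>edge_pt u v 1 = vertex_pt v\<close> hold as equations between functions.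
\<close>

definition vertex_pt :: "'a \<Rightarrow> 'a \<Rightarrow> real" where
  "vertex_pt u = (\<lambda>w. of_bool (w = u))"

definition edge_pt :: "'a \<Rightarrow> 'a \<Rightarrow> real \<Rightarrow> 'a \<Rightarrow> real" where
  "edge_pt u v t = (\<lambda>w. (1 - t) * vertex_pt u w + t * vertex_pt v w)"

definition points :: "'a pair_pre_digraph \<Rightarrow> ('a \<Rightarrow> real) set" where
  "points G = vertex_pt ` pverts G \<union>
     {edge_pt u v t | u v t. (u, v) \<in> parcs G \<and> t \<in> {0..1}}"

text \<open>
  \<open>path_length G p q l\<close>: some path from \<open>p\<close> to \<open>q\<close> composed of finitely many segments, each
  contained in one closed edge (identified isometrically with \<open>[0,1]\<close>), has length \<open>l\<close>.
\<close>

inductive path_length ::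
  "'a pair_pre_digraph \<Rightarrow> ('a \<Rightarrow> real) \<Rightarrow> ('a \<Rightarrow> real) \<Rightarrow> real \<Rightarrow> bool" for G where
  refl: "p \<in> points G \<Longrightarrow> path_length G p p 0"
| step: "\<lbrakk>(u, v) \<in> parcs G; s \<in> {0..1}; t \<in> {0..1}; path_length G (edge_pt u v t) q l\<rbrakk>
         \<Longrightarrow> path_length G (edge_pt u v s) q (\<bar>s - t\<bar> + l)"

definition gdist :: "'a pair_pre_digraph \<Rightarrow> ('a \<Rightarrow> real) \<Rightarrow> ('a \<Rightarrow> real) \<Rightarrow> real" where
  "gdist G p q = Inf {l. path_length G p q l}"

definition is_geodesic ::
  "'a pair_pre_digraph \<Rightarrow> ('a \<Rightarrow> real) \<Rightarrow> ('a \<Rightarrow> real) \<Rightarrow> ('a \<Rightarrow> real) set \<Rightarrow> bool" where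
  "is_geodesic G x y S \<longleftrightarrow> (\<exists>\<gamma> :: real \<Rightarrow> 'a \<Rightarrow> real.
     \<gamma> 0 = x \<and> \<gamma> (gdist G x y) = y \<and> S = \<gamma> ` {0..gdist G x y} \<and> S \<subseteq> points G \<and>
     (\<forall>s\<in>{0..gdist G x y}. \<forall>t\<in>{0..gdist G x y}. gdist G (\<gamma> s) (\<gamma> t) = \<bar>s - t\<bar>))"


section \<open>Hyperbolicity constant\<close>

text \<open>A triangle is given by its three sides; coinciding corners are allowed.\<close>

definition geodesic_triangle ::
  "'a pair_pre_digraph \<Rightarrow> ('a \<Rightarrow> real) set \<Rightarrow> ('a \<Rightarrow> real) set \<Rightarrow> ('a \<Rightarrow> real) set \<Rightarrow> bool" where
  "geodesic_triangle G A B C \<longleftrightarrow> (\<exists>x\<in>points G. \<exists>y\<in>points G. \<exists>z\<in>points G.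
     is_geodesic G x y A \<and> is_geodesic G y z B \<and> is_geodesic G z x C)"

definition neighbourhood ::
  "'a pair_pre_digraph \<Rightarrow> real \<Rightarrow> ('a \<Rightarrow> real) set \<Rightarrow> ('a \<Rightarrow> real) set" where
  "neighbourhood G r S = {p \<in> points G. \<exists>q\<in>S. gdist G p q \<le> r}"

definition triangle_delta ::
  "'a pair_pre_digraph \<Rightarrow> ('a \<Rightarrow> real) set \<Rightarrow> ('a \<Rightarrow> real) set \<Rightarrow> ('a \<Rightarrow> real) set \<Rightarrow> real" where
  "triangle_delta G A B C = Inf {r. 0 \<le> r \<and>
     A \<subseteq> neighbourhood G r (B \<union> C) \<and>
     B \<subseteq> neighbourhood G r (C \<union> A) \<and>
     C \<subseteq> neighbourhood G r (A \<union> B)}"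

text \<open>
  For finite connected graphs the set below is nonempty and bounded by the diameter, so the
  real supremum is the intended one.
\<close>

definition hyperbolicity :: "'a pair_pre_digraph \<Rightarrow> real" where
  "hyperbolicity G = Sup {triangle_delta G A B C | A B C. geodesic_triangle G A B C}"


section \<open>The extremal problem\<close>

text \<open>
  The vertices are natural numbers; up to isomorphism this covers all finite graphs.
\<close>

definition graphs_gcn :: "nat \<Rightarrow> nat \<Rightarrow> nat \<Rightarrow> nat pair_pre_digraph set" where
  "graphs_gcn g c n = {G. fin_simple_connected G \<and>
     girth G = enat g \<and> circumference G = enat c \<and> card (pverts G) = n}"

definition v_admissible :: "nat \<Rightarrow> nat \<Rightarrow> nat \<Rightarrow> bool" where
  "v_admissible g c n \<longleftrightarrow> graphs_gcn g c n \<noteq> {}"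

text \<open>
  \<open>LEAST\<close> denotes the minimum: an attained lower bound. (\<open>Min\<close> would presuppose
  finiteness of the set of values.)
\<close>

definition min_hyperbolicity :: "nat \<Rightarrow> nat \<Rightarrow> nat \<Rightarrow> real" where
  "min_hyperbolicity g c n = (LEAST r. r \<in> hyperbolicity ` graphs_gcn g c n)"

end

theory Submission
  imports Defs
begin

text \<open>
  Lower bounds: an isometrically embedded cycle of length \<open>L\<close> forces hyperbolicity at least
  \<open>L / 4\<close>, by the triangle consisting of its two halves. A 4-cycle without triangles is isometric.
  If the circumference is odd, a shortest odd closed walk is isometric and has length at least 5.

  Upper bounds: the hyperbolicity is at most half the diameter, since every point of a geodesic is
  near one of its ends. The complete bipartite graph with parts of sizes \<open>c / 2\<close> and \<open>n - c / 2\<close>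
  has diameter 2. For odd \<open>c\<close>, replacing two adjacent vertices of a pentagon by independent sets of
  sizes \<open>(c - 3) / 2\<close> and \<open>n - 3 - (c - 3) / 2\<close> gives diameter \<open>5 / 2\<close>; the only pair \<open>(c, n)\<close> where
  this graph has no 4-cycle is \<open>(5, 5)\<close>, which is not v-admissible.
\<close>

section \<open>Paths, geodesics and cycles\<close>

text \<open>The metric is an infimum over segment paths, so the obstacle is bounding distances from
  below. Every path is therefore compared with a normal form: leave the edge of one point through an
  end, walk along whole edges, enter the edge of the other point. In barycentric coordinates the
  offset of \<open>p\<close> from an end \<open>x\<close> is \<open>1 - p x\<close>, which does not
  depend on an orientation of the edge. The constants come from averaging. Between two edges there
  are two routes, one for each pair of matched ends, and their total length is 2 plus the lengths of
  the two connecting walks. Edges of a complete bipartite graph can be matched with walks of total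
  length 2, edges of a pentagon with 3; the shorter route gives diameters 2 and 5/2. Replacing
  vertices by independent sets preserves these bounds and leaves the number of vertices free, while
  a small vertex cover still controls the longest cycle.\<close>

lemma edge_pt_swap: "edge_pt u v t = edge_pt v u (1 - t)"
  by (auto simp: edge_pt_def)

lemma edge_pt_0 [simp]: "edge_pt u v 0 = vertex_pt u"
  and edge_pt_1 [simp]: "edge_pt u v 1 = vertex_pt v"
  by (auto simp: edge_pt_def)

lemma edge_pt_apply:
  assumes "u \<noteq> v"
  shows "edge_pt u v t x = (if x = u then 1 - t else if x = v then t else 0)"
  using assms by (auto simp: edge_pt_def vertex_pt_def)

text \<open>An interior point has exactly two positive coordinates, so its support determines the
  edge up to orientation. Endpoints are excluded because several edges may share them.\<close>

lemma edge_pt_eqD: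
  assumes "edge_pt u v t = edge_pt u' v' s" "u \<noteq> v" "u' \<noteq> v'" "0 < t" "t < 1"
  shows "(u' = u \<and> v' = v \<and> s = t) \<or> (u' = v \<and> v' = u \<and> s = 1 - t)"
proof -
  have "edge_pt u v t x = edge_pt u' v' s x" for x using assms(1) by simp
  note eq = this[unfolded edge_pt_apply[OF assms(2)] edge_pt_apply[OF assms(3)]]
  show ?thesis using eq[of u] eq[of v] assms(2-) by (auto split: if_splits)
qed

lemma path_length_points: "path_length G p q l \<Longrightarrow> p \<in> points G \<and> q \<in> points G"
  by (induction rule: path_length.induct) (auto simp: points_def)

lemma path_length_nonneg: "path_length G p q l \<Longrightarrow> 0 \<le> l"
  by (induction rule: path_length.induct) auto

lemma path_length_trans:
  "path_length G p q l \<Longrightarrow> path_length G q r m \<Longrightarrow> path_length G p r (l + m)"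
  by (induction rule: path_length.induct) (auto simp: add.assoc intro: path_length.step)

lemma path_length_segment:
  assumes "(u, v) \<in> parcs G" "s \<in> {0..1}" "t \<in> {0..1}"
  shows "path_length G (edge_pt u v s) (edge_pt u v t) \<bar>s - t\<bar>"
proof -
  have "edge_pt u v t \<in> points G" using assms unfolding points_def by blast
  from path_length.step[OF assms path_length.refl[OF this]] show ?thesis by simp
qed

lemma path_length_sym: "path_length G p q l \<Longrightarrow> path_length G q p l"
proof (induction rule: path_length.induct)
  case (refl p)
  then show ?case by (rule path_length.refl)
next
  case (step u v s t q l)
  then show ?case
    using path_length_trans[OF step.IH path_length_segment[of u v G t s]]
    by (simp add: add.commute abs_minus_commute)
qed

lemma gdist_le: "path_length G p q l \<Longrightarrow> gdist G p q \<le> l"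
  unfolding gdist_def by (rule cInf_lower) (auto intro!: bdd_belowI[of _ 0] path_length_nonneg)

lemma gdist_commute: "gdist G p q = gdist G q p"
  unfolding gdist_def by (rule arg_cong[where f = Inf]) (auto intro: path_length_sym)

lemma gdist_self [simp]:
  assumes "p \<in> points G"
  shows "gdist G p p = 0"
proof (rule antisym)
  show "gdist G p p \<le> 0" by (intro gdist_le path_length.refl assms)
  show "0 \<le> gdist G p p" unfolding gdist_def
    using path_length.refl[OF assms]
    by (intro cInf_greatest) (auto intro: path_length_nonneg)
qed

lemma is_geodesic_self: "x \<in> points G \<Longrightarrow> is_geodesic G x x {x}"
  unfolding is_geodesic_def by (auto intro!: exI[of _ "\<lambda>_. x"])

text \<open>Nonnegativity is assumed because without any connecting path \<open>gdist\<close> is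
  \<open>Inf {}\<close>, of unknown sign, and the parameter interval might be empty.\<close>

lemma is_geodesic_ends:
  assumes "is_geodesic G x y S" "0 \<le> gdist G x y"
  shows "x \<in> S" "y \<in> S"
  using assms unfolding is_geodesic_def by (metis atLeastAtMost_iff image_eqI order_refl)+

lemma is_geodesic_near_ends:
  assumes "is_geodesic G x y S" "p \<in> S" "gdist G x y \<le> D"
  shows "gdist G p x \<le> D / 2 \<or> gdist G p y \<le> D / 2"
proof -
  obtain g where g: "g 0 = x" "g (gdist G x y) = y" "S = g ` {0..gdist G x y}"
    "\<forall>s\<in>{0..gdist G x y}. \<forall>t\<in>{0..gdist G x y}. gdist G (g s) (g t) = \<bar>s - t\<bar>"
    using assms(1) unfolding is_geodesic_def by blast
  obtain s where s: "s \<in> {0..gdist G x y}" "p = g s" using g(3) assms(2) by blast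
  have "gdist G p x = s" using g(1) g(4)[rule_format, OF s(1), of 0] s by auto
  moreover have "gdist G p y = gdist G x y - s"
    using g(2) g(4)[rule_format, OF s(1), of "gdist G x y"] s by auto
  ultimately show ?thesis using assms(3) by linarith
qed

lemma is_geodesic_points: "is_geodesic G x y S \<Longrightarrow> S \<subseteq> points G"
  unfolding is_geodesic_def by blast

text \<open>Translates arc lists into vertex sequences, so that later arguments about cycles can
  work with indices, periodicity and injectivity.\<close>

lemma cycle_lengths_iff:
  "k \<in> cycle_lengths G \<longleftrightarrow> 3 \<le> k \<and> (\<exists>w :: nat \<Rightarrow> 'a. inj_on w {..<k} \<and> w k = w 0 \<and>
     w 0 \<in> pverts G \<and> (\<forall>i<k. (w i, w (Suc i)) \<in> parcs G))"
  for G :: "'a pair_pre_digraph"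
proof -
  interpret pair_pre_digraph G .
  have vs: "pawalk_verts u p = map fst p @ [v]" if "pcas u p v" for u v and p :: "('a \<times> 'a) list"
    using that by (induction p arbitrary: u) auto
  have cas: "pcas u p v \<longleftrightarrow> (\<exists>w. w 0 = u \<and> w (length p) = v \<and>
     p = map (\<lambda>i. (w i, w (Suc i))) [0..<length p])" (is "_ \<longleftrightarrow> ?R p u") for u v :: 'a and p
  proof (induction p arbitrary: u)
    case Nil
    then show ?case by (auto intro!: exI[of _ "\<lambda>_. u"])
  next
    case (Cons e p)
    have "?R (e # p) u \<longleftrightarrow> fst e = u \<and> ?R p (snd e)"
    proof (intro iffI)
      assume "?R (e # p) u"
      then obtain w where *: "w 0 = u" "w (length (e # p)) = v"
        "e # p = map (\<lambda>i. (w i, w (Suc i))) [0..<Suc (length p)]" by auto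
      have 2: "map (\<lambda>i. (w i, w (Suc i))) [0..<Suc (length p)] =
         (w 0, w 1) # map (\<lambda>i. (w (Suc i), w (Suc (Suc i)))) [0..<length p]"
        unfolding upt_conv_Cons[OF zero_less_Suc] map_Suc_upt[symmetric] by (simp add: o_def)
      show "fst e = u \<and> ?R p (snd e)"
        using * 2 by (auto intro!: exI[of _ "\<lambda>i. w (Suc i)"] simp del: upt_Suc)
    next
      assume "fst e = u \<and> ?R p (snd e)"
      then obtain w where *: "fst e = u" "w 0 = snd e" "w (length p) = v"
        "p = map (\<lambda>i. (w i, w (Suc i))) [0..<length p]" by blast
      define w' where "w' = case_nat (fst e) w"
      have 2: "map (\<lambda>i. (w' i, w' (Suc i))) [0..<Suc (length p)] =
         (w' 0, w' 1) # map (\<lambda>i. (w' (Suc i), w' (Suc (Suc i)))) [0..<length p]"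
        unfolding upt_conv_Cons[OF zero_less_Suc] map_Suc_upt[symmetric] by (simp add: o_def)
      show "?R (e # p) u"
        using * 2 by (intro exI[of _ w']) (auto simp: w'_def simp del: upt_Suc)
    qed
    then show ?case using Cons by simp
  qed
  show ?thesis
  proof safe
    assume "k \<in> cycle_lengths G"
    then obtain p u where p: "length p = k" "3 \<le> k" "awalk u p u" "distinct (tl (pawalk_verts u p))"
      unfolding cycle_lengths_def cycle_def by auto
    then have c: "pcas u p u" and E: "set p \<subseteq> parcs G" "u \<in> pverts G" unfolding awalk_def by auto
    obtain w where w: "w 0 = u" "w (length p) = u"
      "p = map (\<lambda>i. (w i, w (Suc i))) [0..<length p]" using c cas by blast
    show "3 \<le> k" by fact
    have ne: "p \<noteq> []" using p by auto
    \<comment> \<open>In a closed walk the tail of the vertex list is a rotation of the list of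
      start vertices.\<close>
    have "distinct (map fst p)"
      using p(4) vs[OF c] c ne by (cases p) auto
    also have "map fst p = map w [0..<k]" by (subst w(3)) (simp add: p(1))
    finally have "inj_on w {..<k}" by (simp add: distinct_map atLeast0LessThan)
    moreover have "(w i, w (Suc i)) \<in> parcs G" if "i < k" for i
      using E that p(1) by (subst (asm) w(3)) auto
    ultimately show "\<exists>w. inj_on w {..<k} \<and> w k = w 0 \<and> w 0 \<in> pverts G \<and>
        (\<forall>i<k. (w i, w (Suc i)) \<in> parcs G)"
      using w p E by auto
  next
    fix w assume w: "inj_on w {..<k}" "w k = w 0" "w 0 \<in> pverts G"
      "\<forall>i<k. (w i, w (Suc i)) \<in> parcs G" and k: "3 \<le> k"
    define p where "p = map (\<lambda>i. (w i, w (Suc i))) [0..<k]"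
    have c: "pcas (w 0) p (w 0)" unfolding cas by (rule exI[of _ w]) (simp add: p_def w)
    have "p \<noteq> []" using k by (simp add: p_def)
    have "distinct (map fst p)" using w(1) by (simp add: p_def distinct_map o_def atLeast0LessThan inj_on_def)
    then have "distinct (tl (pawalk_verts (w 0) p))" unfolding vs[OF c]
      using c \<open>p \<noteq> []\<close> by (cases p) auto
    moreover have "awalk (w 0) p (w 0)" using c w by (auto simp: awalk_def p_def)
    ultimately show "k \<in> cycle_lengths G" unfolding cycle_lengths_def cycle_def using k \<open>p \<noteq> []\<close>
      by (auto simp: p_def intro!: exI[of _ p])
  qed
qed

lemma girth_eq_iff:
  "girth G = enat g \<longleftrightarrow> g \<in> cycle_lengths G \<and> (\<forall>k\<in>cycle_lengths G. g \<le> k)"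
proof
  assume g: "girth G = enat g"
  then have "cycle_lengths G \<noteq> {}" by (auto simp: girth_def Inf_enat_def)
  then have "(INF k\<in>cycle_lengths G. enat k) \<in> enat ` cycle_lengths G"
    by (metis (no_types, lifting) Inf_enat_def LeastI ex_in_conv image_is_empty)
  then show "g \<in> cycle_lengths G \<and> (\<forall>k\<in>cycle_lengths G. g \<le> k)"
    using g unfolding girth_def by (metis INF_lower enat.inject enat_ord_simps(1) imageE)
next
  assume "g \<in> cycle_lengths G \<and> (\<forall>k\<in>cycle_lengths G. g \<le> k)"
  then show "girth G = enat g" unfolding girth_def
    by (intro antisym INF_lower2[of g] INF_greatest) auto
qed

text \<open>A finite supremum bounds the cycle lengths, so it is attained; \<open>0 < c\<close>
  rules out the value of an acyclic graph.\<close>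

lemma circumference_eqD:
  assumes "circumference G = enat c" "0 < c"
  shows "c \<in> cycle_lengths G"
proof -
  have ne: "cycle_lengths G \<noteq> {}"
    using assms by (auto simp: circumference_def bot_enat_def zero_enat_def)
  have "k \<le> c" if "k \<in> cycle_lengths G" for k
    using that assms(1) by (metis SUP_upper circumference_def enat_ord_simps(1))
  then have fin: "finite (cycle_lengths G)" by (meson finite_nat_set_iff_bounded_le)
  have "circumference G = Max (enat ` cycle_lengths G)"
    using ne fin by (simp add: circumference_def Sup_enat_def)
  also have "\<dots> \<in> enat ` cycle_lengths G" using ne fin by (intro Max_in) auto
  finally show ?thesis using assms by auto
qed

lemma circumference_eqI:
  assumes "c \<in> cycle_lengths G" "\<And>k. k \<in> cycle_lengths G \<Longrightarrow> k \<le> c"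
  shows "circumference G = enat c"
  unfolding circumference_def using assms by (intro antisym SUP_upper2[of c] SUP_least) auto

section \<open>Finite connected graphs\<close>

locale conn_graph =
  fixes G :: "'a pair_pre_digraph"
  assumes fin_simple_connected: "fin_simple_connected G"
begin

lemma pair_graph: "pair_graph G"
  using fin_simple_connected by (simp add: fin_simple_connected_def)

lemma arc_sym: "(u, v) \<in> parcs G \<Longrightarrow> (v, u) \<in> parcs G"
proof -
  interpret pair_graph G by (rule pair_graph)
  show "(u, v) \<in> parcs G \<Longrightarrow> (v, u) \<in> parcs G" by (rule arcs_symmetric)
qed

lemma arc_irrefl: "(u, u) \<notin> parcs G"
proof -
  interpret pair_graph G by (rule pair_graph)
  show ?thesis using pair_no_loops by fastforce
qed

lemma arc_verts: "(u, v) \<in> parcs G \<Longrightarrow> u \<in> pverts G" "(u, v) \<in> parcs G \<Longrightarrow> v \<in> pverts G"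
proof -
  interpret pair_graph G by (rule pair_graph)
  show "(u, v) \<in> parcs G \<Longrightarrow> u \<in> pverts G" "(u, v) \<in> parcs G \<Longrightarrow> v \<in> pverts G"
    by (rule in_arcsD1 in_arcsD2, assumption)+
qed

lemma finite_verts: "finite (pverts G)"
proof -
  interpret pair_graph G by (rule pair_graph)
  show ?thesis by (rule pair_finite_verts)
qed

lemma strongly_connected: "strongly_connected (with_proj G)"
proof -
  interpret pair_graph G by (rule pair_graph)
  show ?thesis using fin_simple_connected symmetric_connected_imp_strongly_connected[OF pair_sym_arcs]
    by (simp add: fin_simple_connected_def)
qed

lemma verts_nonempty: "pverts G \<noteq> {}"
  using strongly_connected by (simp add: strongly_connected_def)

text \<open>From here on a walk of length \<open>k\<close>, repetitions allowed, is a pair in the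
  relation power \<open>parcs G ^^ k\<close>.\<close>

lemma walk_exists:
  assumes "u \<in> pverts G" "v \<in> pverts G"
  shows "\<exists>k. (u, v) \<in> parcs G ^^ k"
proof -
  have "u \<rightarrow>\<^sup>*\<^bsub>with_proj G\<^esub> v" using strongly_connected assms by (simp add: strongly_connected_def)
  then have "(u, v) \<in> (parcs G)\<^sup>*"
    unfolding reachable_def with_proj_simps by (rule rtrancl_on_rtranclI)
  then show ?thesis by (simp add: rtrancl_power)
qed

lemma walk_sym: "(u, v) \<in> parcs G ^^ k \<Longrightarrow> (v, u) \<in> parcs G ^^ k"
proof (induction k arbitrary: v)
  case (Suc k)
  then show ?case by (meson arc_sym relpow_Suc_E relpow_Suc_I2)
qed auto

lemma vertex_pt_in_points: "u \<in> pverts G \<Longrightarrow> vertex_pt u \<in> points G"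
  by (auto simp: points_def)

lemma path_length_walk:
  "(u, v) \<in> parcs G ^^ k \<Longrightarrow> u \<in> pverts G \<Longrightarrow> path_length G (vertex_pt u) (vertex_pt v) k"
proof (induction k arbitrary: v)
  case 0
  then show ?case by (auto intro: path_length.refl vertex_pt_in_points)
next
  case (Suc k)
  then obtain w where w: "(u, w) \<in> parcs G ^^ k" "(w, v) \<in> parcs G" by auto
  have "path_length G (vertex_pt w) (vertex_pt v) 1"
    using path_length_segment[of w v G 0 1] w(2) by simp
  from path_length_trans[OF Suc.IH[OF w(1) Suc.prems(2)] this] show ?case
    by (simp add: add.commute)
qed

lemma point_near_vertex:
  assumes "p \<in> points G"
  shows "\<exists>u l. u \<in> pverts G \<and> l \<le> 1 \<and> path_length G p (vertex_pt u) l"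
proof -
  consider u where "u \<in> pverts G" "p = vertex_pt u"
    | u v t where "(u, v) \<in> parcs G" "t \<in> {0..1}" "p = edge_pt u v t"
    using assms unfolding points_def by blast
  then show ?thesis
  proof cases
    case 1
    then show ?thesis using path_length.refl[OF assms] zero_le_one by blast
  next
    case 2
    then show ?thesis using path_length_segment[of u v G t 0] arc_verts[of u v]
      by (intro exI[of _ u] exI[of _ "\<bar>t - 0\<bar>"]) auto
  qed
qed

text \<open>Finitely many vertex pairs have a common bound on their connecting walks, and each end
  costs at most 1. This makes the infima range over nonempty sets and gives a finite
  diameter.\<close>

lemma path_length_bounded:
  "\<exists>D. \<forall>p\<in>points G. \<forall>q\<in>points G. \<exists>l\<le>D. path_length G p q l"
proof -
  define k where "k = (\<lambda>(u, v). SOME k. (u, v) \<in> parcs G ^^ k)"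
  have k: "(u, v) \<in> parcs G ^^ (k (u, v))" if "u \<in> pverts G" "v \<in> pverts G" for u v
    using someI_ex[OF walk_exists[OF that]] by (simp add: k_def)
  define M where "M = Max (k ` (pverts G \<times> pverts G))"
  have M: "k (u, v) \<le> M" if "u \<in> pverts G" "v \<in> pverts G" for u v
    unfolding M_def using that finite_verts by (intro Max_ge) auto
  show ?thesis
  proof (rule exI[of _ "real M + 2"], intro ballI)
    fix p q assume "p \<in> points G" "q \<in> points G"
    then obtain u l v m where *: "u \<in> pverts G" "l \<le> 1" "path_length G p (vertex_pt u) l"
      "v \<in> pverts G" "m \<le> 1" "path_length G q (vertex_pt v) m"
      by (meson point_near_vertex)
    have "path_length G p q (l + (real (k (u, v)) + m))"
      by (rule path_length_trans[OF *(3) path_length_trans[OF path_length_walk[OF k]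
        path_length_sym[OF *(6)]]]) (use * in auto)
    moreover have "l + (real (k (u, v)) + m) \<le> real M + 2"
      using * M[of u v] by linarith
    ultimately show "\<exists>l\<le>real M + 2. path_length G p q l" by blast
  qed
qed

lemma gdist_geI:
  assumes "p \<in> points G" "q \<in> points G" "\<And>l. path_length G p q l \<Longrightarrow> B \<le> l"
  shows "B \<le> gdist G p q"
proof -
  have "{l. path_length G p q l} \<noteq> {}" using path_length_bounded assms by blast
  then show ?thesis unfolding gdist_def using assms by (intro cInf_greatest) auto
qed

lemma gdist_nonneg: "p \<in> points G \<Longrightarrow> q \<in> points G \<Longrightarrow> 0 \<le> gdist G p q"
  by (intro gdist_geI path_length_nonneg)

lemma gdist_triangle:
  assumes "p \<in> points G" "q \<in> points G" "r \<in> points G"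
  shows "gdist G p r \<le> gdist G p q + gdist G q r"
proof -
  have "gdist G p r - gdist G q r \<le> l" if l: "path_length G p q l" for l
  proof -
    have "gdist G p r - l \<le> gdist G q r"
    proof (rule gdist_geI[OF assms(2,3)])
      fix m assume "path_length G q r m"
      from gdist_le[OF path_length_trans[OF l this]] show "gdist G p r - l \<le> m" by simp
    qed
    then show ?thesis by simp
  qed
  from gdist_geI[OF assms(1,2) this] show ?thesis by simp
qed

section \<open>Bounding the hyperbolicity of a triangle and of the graph\<close>

definition admissible_radii where
  "admissible_radii A B C = {r. 0 \<le> r \<and>
     A \<subseteq> neighbourhood G r (B \<union> C) \<and>
     B \<subseteq> neighbourhood G r (C \<union> A) \<and>
     C \<subseteq> neighbourhood G r (A \<union> B)}"

lemma triangle_delta_alt: "triangle_delta G A B C = Inf (admissible_radii A B C)"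
  by (simp add: triangle_delta_def admissible_radii_def)

text \<open>Each corner lies on two sides, so both ends of a side belong to the union of the other
  two. Membership is kept apart from the bound on the infimum because it also shows that admissible
  radii exist.\<close>

lemma half_diameter_admissible:
  assumes D: "\<And>p q. p \<in> points G \<Longrightarrow> q \<in> points G \<Longrightarrow> gdist G p q \<le> D"
    and T: "geodesic_triangle G A B C"
  shows "D / 2 \<in> admissible_radii A B C"
proof -
  have side: "S \<subseteq> neighbourhood G (D / 2) T"
    if "is_geodesic G x y S" "x \<in> points G" "y \<in> points G" "x \<in> T" "y \<in> T" for x y S T
  proof
    fix p assume "p \<in> S"
    then show "p \<in> neighbourhood G (D / 2) T"
      using is_geodesic_near_ends[OF that(1) \<open>p \<in> S\<close> D[OF that(2,3)]] is_geodesic_points[OF that(1)]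
        that(4,5) unfolding neighbourhood_def by auto
  qed
  obtain x y z where *: "x \<in> points G" "y \<in> points G" "z \<in> points G"
    "is_geodesic G x y A" "is_geodesic G y z B" "is_geodesic G z x C"
    using T unfolding geodesic_triangle_def by blast
  have "x \<in> A" "y \<in> A" "y \<in> B" "z \<in> B" "z \<in> C" "x \<in> C"
    using is_geodesic_ends[OF *(4)] is_geodesic_ends[OF *(5)] is_geodesic_ends[OF *(6)]
    by (auto intro: gdist_nonneg *)
  moreover have "0 \<le> D" using D[of x x] gdist_nonneg[of x x] * by force
  ultimately show ?thesis unfolding admissible_radii_def
    using side[OF *(4,1,2), of "B \<union> C"] side[OF *(5,2,3), of "C \<union> A"] side[OF *(6,3,1), of "A \<union> B"]
    by simp
qed

lemma triangle_delta_le: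
  assumes "\<And>p q. p \<in> points G \<Longrightarrow> q \<in> points G \<Longrightarrow> gdist G p q \<le> D"
    and "geodesic_triangle G A B C"
  shows "triangle_delta G A B C \<le> D / 2"
  unfolding triangle_delta_alt
  by (intro cInf_lower half_diameter_admissible assms)
     (auto intro!: bdd_belowI[of _ 0] simp: admissible_radii_def)

lemma gdist_bounded: "\<exists>D. \<forall>p\<in>points G. \<forall>q\<in>points G. gdist G p q \<le> D"
proof -
  obtain D where "\<forall>p\<in>points G. \<forall>q\<in>points G. \<exists>l\<le>D. path_length G p q l"
    using path_length_bounded by blast
  then have "gdist G p q \<le> D" if "p \<in> points G" "q \<in> points G" for p q
    using gdist_le[of G p q] order_trans that by blast
  then show ?thesis by blast
qed

lemma hyperbolicity_le:
  assumes "\<And>p q. p \<in> points G \<Longrightarrow> q \<in> points G \<Longrightarrow> gdist G p q \<le> D"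
  shows "hyperbolicity G \<le> D / 2"
proof -
  obtain u where "u \<in> pverts G" using verts_nonempty by blast
  then have "vertex_pt u \<in> points G" by (rule vertex_pt_in_points)
  \<comment> \<open>The one-point triangle makes the set nonempty, as the conditional supremum
    requires.\<close>
  then have "\<exists>A B C. geodesic_triangle G A B C"
    unfolding geodesic_triangle_def using is_geodesic_self by blast
  then have "{triangle_delta G A B C |A B C. geodesic_triangle G A B C} \<noteq> {}" by blast
  moreover have "d \<le> D / 2" if "d \<in> {triangle_delta G A B C |A B C. geodesic_triangle G A B C}" for d
    using that triangle_delta_le[OF assms] by blast
  ultimately show ?thesis unfolding hyperbolicity_def by (rule cSup_least)
qed

text \<open>One point of a side that is far from the other two sides already pushes up every
  admissible radius.\<close>

lemma triangle_delta_geI: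
  assumes "geodesic_triangle G A B C"
    and "p \<in> A" "\<And>q. q \<in> B \<union> C \<Longrightarrow> b \<le> gdist G p q"
  shows "b \<le> triangle_delta G A B C"
proof -
  obtain D where D: "\<And>p q. p \<in> points G \<Longrightarrow> q \<in> points G \<Longrightarrow> gdist G p q \<le> D"
    using gdist_bounded by blast
  show ?thesis unfolding triangle_delta_alt
  proof (rule cInf_greatest)
    show "admissible_radii A B C \<noteq> {}" using half_diameter_admissible[OF D assms(1)] by blast
    fix r assume "r \<in> admissible_radii A B C"
    then obtain q where "q \<in> B \<union> C" "gdist G p q \<le> r"
      using assms(2) unfolding admissible_radii_def neighbourhood_def by blast
    then show "b \<le> r" using assms(3) by force
  qed
qed

lemma triangle_delta_le_hyperbolicity:
  assumes "geodesic_triangle G A B C"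
  shows "triangle_delta G A B C \<le> hyperbolicity G"
proof -
  obtain D where D: "\<And>p q. p \<in> points G \<Longrightarrow> q \<in> points G \<Longrightarrow> gdist G p q \<le> D"
    using gdist_bounded by blast
  show ?thesis unfolding hyperbolicity_def
    using assms triangle_delta_le[OF D] by (intro cSup_upper bdd_aboveI[of _ "D / 2"]) auto
qed

section \<open>From paths in the metric space to walks in the graph\<close>

lemma arc_neq: "(u, v) \<in> parcs G \<Longrightarrow> u \<noteq> v"
  using arc_irrefl by auto

text \<open>A positive coordinate \<open>p x\<close> says that \<open>x\<close> is an end of an edge
  containing \<open>p\<close>, at offset \<open>1 - p x\<close>. A segment starting at a vertex is
  traded for a walk of length 0 or 1 followed by such an offset.\<close>

lemma vertex_on_edge_walk:
  assumes "(u, v) \<in> parcs G" "s \<in> {0..1}" "t \<in> {0..1}" "edge_pt u v s = vertex_pt x"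
  shows "\<exists>y k. 0 < edge_pt u v t y \<and> (x, y) \<in> parcs G ^^ k \<and> k + (1 - edge_pt u v t y) \<le> \<bar>s - t\<bar>"
proof -
  have ne: "u \<noteq> v" using arc_neq assms(1) .
  have *: "\<exists>y k. 0 < edge_pt u v t y \<and> (u, y) \<in> parcs G ^^ k \<and> k + (1 - edge_pt u v t y) \<le> t"
    if "(u, v) \<in> parcs G" "t \<in> {0..1}" for u v t
  \<comment> \<open>At \<open>t = 1\<close> the coordinate of \<open>u\<close> vanishes, so the walk
    has to take the whole edge and the offset is 0.\<close>
  proof (cases "t = 1")
    case True
    then show ?thesis using that arc_neq[OF that(1)]
      by (intro exI[of _ v] exI[of _ 1]) (auto simp: edge_pt_apply vertex_pt_def)
  next
    case False
    then show ?thesis using that arc_neq[OF that(1)]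
      by (intro exI[of _ u] exI[of _ 0]) (auto simp: edge_pt_apply)
  qed
  have "edge_pt u v s x = 1" using assms(4) by (simp add: vertex_pt_def)
  then consider "x = u" "s = 0" | "x = v" "s = 1"
    using assms(2) ne by (auto simp: edge_pt_apply split: if_splits)
  then show ?thesis
  proof cases
    case 1
    then show ?thesis using *[OF assms(1,3)] assms(3) by auto
  next
    case 2
    then show ?thesis using *[OF arc_sym[OF assms(1)], of "1 - t"] assms(3)
      by (auto simp: edge_pt_swap[of u v t])
  qed
qed

text \<open>The exit through \<open>x\<close> stays available from the new starting point, at a cost
  covered by the triangle inequality on the edge. Only if the new point is the opposite end does its
  coordinate at \<open>x\<close> vanish, and then the edge becomes a further step of the
  walk.\<close>

lemma prepend_segment_walk:
  assumes "(u, v) \<in> parcs G" "s \<in> {0..1}" "t \<in> {0..1}"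
    and "0 < edge_pt u v t x" "(x, y) \<in> parcs G ^^ k"
  shows "\<exists>x' k'. 0 < edge_pt u v s x' \<and> (x', y) \<in> parcs G ^^ k' \<and>
    (1 - edge_pt u v s x') + k' \<le> \<bar>s - t\<bar> + (1 - edge_pt u v t x) + k"
proof -
  have *: "\<exists>x' k'. 0 < edge_pt u v s x' \<and> (x', y) \<in> parcs G ^^ k' \<and>
      (1 - edge_pt u v s x') + k' \<le> \<bar>s - t\<bar> + t + k"
    if "(u, v) \<in> parcs G" "s \<in> {0..1}" "t \<in> {0..1}" "(u, y) \<in> parcs G ^^ k" for u v s t
  proof (cases "s = 1")
    case True
    have "(v, y) \<in> parcs G ^^ Suc k" using that by (meson arc_sym relpow_Suc_I2)
    then show ?thesis using that arc_neq[OF that(1)] True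
      by (intro exI[of _ v] exI[of _ "Suc k"]) (auto simp: edge_pt_apply vertex_pt_def)
  next
    case False
    then show ?thesis using that arc_neq[OF that(1)]
      by (intro exI[of _ u] exI[of _ k]) (auto simp: edge_pt_apply)
  qed
  have ne: "u \<noteq> v" using arc_neq assms(1) .
  consider "x = u" | "x = v" using assms(4) ne by (auto simp: edge_pt_apply split: if_splits)
  then show ?thesis
  proof cases
    case 1
    then show ?thesis using *[of u v s t] assms ne by (simp add: edge_pt_apply)
  next
    case 2
    have "\<bar>(1 - s) - (1 - t)\<bar> = \<bar>s - t\<bar>" by simp
    then show ?thesis using *[of v u "1 - s" "1 - t"] assms(2,3,5) ne arc_sym[OF assms(1)] 2
      unfolding edge_pt_swap[of v u] by (simp add: edge_pt_apply[OF ne, of t v])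
  qed
qed

text \<open>The normal form of a path: it passes through vertices, or it stays in one edge. The
  induction puts a segment in front. The first alternative absorbs it by
  \<open>prepend_segment_walk\<close>; the second survives if the junction is an interior point and
  turns into the first if the junction is a vertex.\<close>

lemma path_length_cases:
  assumes "path_length G p q l"
  shows "(\<exists>x y k. 0 < p x \<and> 0 < q y \<and> (x, y) \<in> parcs G ^^ k \<and> (1 - p x) + k + (1 - q y) \<le> l) \<or>
    (\<exists>u v s t. (u, v) \<in> parcs G \<and> s \<in> {0..1} \<and> t \<in> {0..1} \<and>
       p = edge_pt u v s \<and> q = edge_pt u v t \<and> \<bar>s - t\<bar> \<le> l)" (is "?W p q l \<or> ?S p q l")
  using assms
proof (induction rule: path_length.induct)
  case (refl p)
  then consider u where "u \<in> pverts G" "p = vertex_pt u"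
    | u v t where "(u, v) \<in> parcs G" "t \<in> {0..1}" "p = edge_pt u v t"
    unfolding points_def by blast
  then show ?case
  proof cases
    case 1
    have "?W p p 0"
      by (intro exI[of _ u] exI[of _ 0]) (simp add: 1 vertex_pt_def)
    then show ?thesis ..
  next
    case 2
    then have "?S p p 0"
      by (intro exI[of _ u] exI[of _ v] exI[of _ t]) auto
    then show ?thesis ..
  qed
next
  case (step u v s t q l)
  have W: ?case if w: "?W (edge_pt u v t) q l"
  proof -
    obtain x y k where w: "0 < edge_pt u v t x" "0 < q y" "(x, y) \<in> parcs G ^^ k"
      "(1 - edge_pt u v t x) + k + (1 - q y) \<le> l" using w by blast
    obtain x' k' where "0 < edge_pt u v s x'" "(x', y) \<in> parcs G ^^ k'"
      "(1 - edge_pt u v s x') + k' \<le> \<bar>s - t\<bar> + (1 - edge_pt u v t x) + k"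
      using prepend_segment_walk[OF step.hyps(1-3) w(1,3)] by blast
    then have "?W (edge_pt u v s) q (\<bar>s - t\<bar> + l)"
      using w by (intro exI[of _ x'] exI[of _ y] exI[of _ k']) auto
    then show ?thesis ..
  qed
  from step.IH show ?case
  proof
    assume "?W (edge_pt u v t) q l" then show ?thesis by (rule W)
  next
    assume "?S (edge_pt u v t) q l"
    then obtain u' v' s' t' where S: "(u', v') \<in> parcs G" "s' \<in> {0..1}" "t' \<in> {0..1}"
      "edge_pt u v t = edge_pt u' v' s'" "q = edge_pt u' v' t'" "\<bar>s' - t'\<bar> \<le> l" by blast
    show ?thesis
    \<comment> \<open>An interior junction lies on a single edge, so the new segment and the rest of
      the path run in the same edge.\<close>
    proof (cases "0 < t \<and> t < 1")
      case True
      then have "\<exists>t''\<in>{0..1}. q = edge_pt u v t'' \<and> \<bar>t - t''\<bar> \<le> l"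
        using edge_pt_eqD[OF S(4) arc_neq[OF step.hyps(1)] arc_neq[OF S(1)]] S
        by (auto intro: bexI[of _ "1 - t'"] simp: edge_pt_swap[of v u])
      then obtain t'' where "t'' \<in> {0..1}" "q = edge_pt u v t''" "\<bar>t - t''\<bar> \<le> l" by blast
      then have "?S (edge_pt u v s) q (\<bar>s - t\<bar> + l)"
        using step.hyps by (intro exI[of _ u] exI[of _ v] exI[of _ s] exI[of _ t'']) auto
      then show ?thesis ..
    next
      case False
      then have "t = 0 \<or> t = 1" using step.hyps by auto
      then obtain x where x: "edge_pt u v t = vertex_pt x" by auto
      then obtain y k where "0 < q y" "(x, y) \<in> parcs G ^^ k" "k + (1 - q y) \<le> \<bar>s' - t'\<bar>"
        using vertex_on_edge_walk[of u' v' s' t' x] S by auto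
      then have "?W (edge_pt u v t) q l"
        using S(6) by (intro exI[of _ x] exI[of _ y] exI[of _ k]) (auto simp: x vertex_pt_def)
      then show ?thesis by (rule W)
    qed
  qed
qed

text \<open>Without a common support vertex, the path has to leave the edge of \<open>p\<close> through a vertex.\<close>

lemma path_length_disjoint_support:
  assumes "path_length G p q l" "\<And>x. p x = 0 \<or> q x = 0"
  shows "\<exists>x y k. 0 < p x \<and> 0 < q y \<and> (x, y) \<in> parcs G ^^ k \<and> (1 - p x) + k + (1 - q y) \<le> l"
  using path_length_cases[OF assms(1)]
proof
  assume "\<exists>u v s t. (u, v) \<in> parcs G \<and> s \<in> {0..1} \<and> t \<in> {0..1} \<and>
       p = edge_pt u v s \<and> q = edge_pt u v t \<and> \<bar>s - t\<bar> \<le> l"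
  then obtain u v s t where *: "(u, v) \<in> parcs G" "s \<in> {0..1}" "t \<in> {0..1}"
    "p = edge_pt u v s" "q = edge_pt u v t" "\<bar>s - t\<bar> \<le> l" by blast
  have ne: "u \<noteq> v" using arc_neq *(1) .
  have "s = 0 \<or> s = 1"
    using assms(2)[of u] assms(2)[of v] * ne by (auto simp: edge_pt_apply)
  then obtain x where x: "p = vertex_pt x" using * by auto
  obtain y k where "0 < q y" "(x, y) \<in> parcs G ^^ k" "k + (1 - q y) \<le> \<bar>s - t\<bar>"
    using vertex_on_edge_walk[of u v s t x] * x by auto
  then show ?thesis
    using *(6) by (intro exI[of _ x] exI[of _ y] exI[of _ k]) (auto simp: x vertex_pt_def)
qed

end

section \<open>Isometric cycles\<close>

text \<open>
  A closed walk \<open>w\<close> of length \<open>L\<close>, indexed periodically, is isometrically embedded: a walk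
  of length \<open>k\<close> between two of its vertices is at least as long as the shorter of the two arcs.
\<close>

locale isometric_cycle = conn_graph G for G :: "'a pair_pre_digraph" +
  fixes w :: "nat \<Rightarrow> 'a" and L :: nat
  assumes length_ge: "4 \<le> L"
    and periodic: "w (i + L) = w i"
    and arc: "(w i, w (Suc i)) \<in> parcs G"
    and isometric: "i \<le> j \<Longrightarrow> (w i, w j) \<in> parcs G ^^ k \<Longrightarrow> j - i \<le> k \<or> L \<le> k + (j - i)"
begin

text \<open>Unit-speed traversal of the closed walk. As \<open>w\<close> itself is periodic,
  arguments beyond \<open>L\<close> need no wrap-around.\<close>

definition param :: "real \<Rightarrow> 'a \<Rightarrow> real" where
  "param t = edge_pt (w (nat \<lfloor>t\<rfloor>)) (w (Suc (nat \<lfloor>t\<rfloor>))) (t - real (nat \<lfloor>t\<rfloor>))"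

text \<open>Both edges meeting at a vertex give the same point there, so the formula extends to the
  right end, where the floor has already moved on.\<close>

lemma param_eq:
  assumes "real i \<le> t" "t \<le> real i + 1"
  shows "param t = edge_pt (w i) (w (Suc i)) (t - real i)"
proof (cases "t = real i + 1")
  case True
  then have "nat \<lfloor>t\<rfloor> = Suc i" by linarith
  then show ?thesis using True by (simp add: param_def)
next
  case False
  then have "nat \<lfloor>t\<rfloor> = i" using assms by linarith
  then show ?thesis by (simp add: param_def)
qed

lemma param_periodic:
  assumes "0 \<le> t"
  shows "param (t + real L) = param t"
proof -
  have "param t = edge_pt (w (nat \<lfloor>t\<rfloor>)) (w (Suc (nat \<lfloor>t\<rfloor>))) (t - real (nat \<lfloor>t\<rfloor>))"
    by (simp add: param_def)
  moreover have "param (t + real L) = edge_pt (w (nat \<lfloor>t\<rfloor> + L)) (w (Suc (nat \<lfloor>t\<rfloor> + L)))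
      (t + real L - real (nat \<lfloor>t\<rfloor> + L))"
    using assms by (intro param_eq) (simp; linarith)+
  ultimately show ?thesis using periodic[of "Suc (nat \<lfloor>t\<rfloor>)"] by (simp add: periodic)
qed

lemma path_length_param:
  assumes "0 \<le> s" "s \<le> t"
  shows "path_length G (param s) (param t) (t - s)"
proof -
  have *: "path_length G (param s) (param t) (t - s)"
    if "real i \<le> s" "s \<le> real i + 1" "real (i + n) \<le> t" "t \<le> real (i + n) + 1" "s \<le> t" for n i s t
    using that
  proof (induction n arbitrary: i s)
    case 0
    then show ?case
      using path_length_segment[OF arc, of "s - real i" "t - real i" i]
      by (simp add: param_eq[of i])
  next
    case (Suc n)
    have "path_length G (param s) (param (real (Suc i))) (real (Suc i) - s)"
      using path_length_segment[OF arc, of "s - real i" 1 i] Suc.prems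
      by (simp add: param_eq[of i] algebra_simps)
    moreover have "path_length G (param (real (Suc i))) (param t) (t - real (Suc i))"
      using Suc.prems by (intro Suc.IH[of "Suc i"]) auto
    ultimately show ?case using path_length_trans by fastforce
  qed
  define i where "i = nat \<lfloor>s\<rfloor>"
  define j where "j = nat \<lfloor>t\<rfloor>"
  have ij: "real i \<le> s" "s \<le> real i + 1" "real j \<le> t" "t \<le> real j + 1" "i \<le> j"
    using assms unfolding i_def j_def by linarith+
  then show ?thesis using *[of i s "j - i" t] assms by simp
qed

lemma param_in_points: "0 \<le> t \<Longrightarrow> param t \<in> points G"
  using path_length_param[of t t] path_length_points by auto

lemma gdist_param_le:
  assumes "0 \<le> s" "0 \<le> t"
  shows "gdist G (param s) (param t) \<le> \<bar>s - t\<bar>"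
proof (cases "s \<le> t")
  case True
  then show ?thesis using gdist_le[OF path_length_param[of s t]] assms by simp
next
  case False
  then show ?thesis using gdist_le[OF path_length_param[of t s]] assms by (simp add: gdist_commute)
qed

text \<open>In normal form a path leaves through one of two ends and arrives through one of two.
  Isometry bounds the walk in between by one of the two arcs of the cycle; adding the offsets gives
  at least \<open>L / 2\<close> in all four cases, because both arcs between antipodal points have
  this length.\<close>

lemma gdist_antipodal:
  assumes "0 \<le> a"
  shows "real L / 2 \<le> gdist G (param a) (param (a + real L / 2))"
proof (rule gdist_geI)
  show "param a \<in> points G" "param (a + real L / 2) \<in> points G"
    using assms by (auto intro: param_in_points)
next
  fix l assume l: "path_length G (param a) (param (a + real L / 2)) l"
  define i where "i = nat \<lfloor>a\<rfloor>"
  define j where "j = nat \<lfloor>a + real L / 2\<rfloor>"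
  define s where "s = a - real i"
  define t where "t = a + real L / 2 - real j"
  have st: "0 \<le> s" "s < 1" "0 \<le> t" "t < 1"
    using assms unfolding s_def t_def i_def j_def by linarith+
  have ji: "real j - real i = real L / 2 + s - t" by (simp add: s_def t_def)
  have L4: "4 \<le> real L" using length_ge by simp
  \<comment> \<open>Here \<open>4 \<le> L\<close> enters: \<open>j - i\<close> exceeds
    \<open>L / 2 - 1 \<ge> 1\<close>, and likewise around the other side, so the two edges share no
    vertex.\<close>
  have "real i < real j" "real (Suc i) < real j" "real j < real i + real L" "real j + 1 < real i + real L"
    using ji st L4 by (auto simp: field_simps)
  then have less: "i < j" "Suc i < j" "j < i + L" "Suc j < i + L" by linarith+
  have p: "param a = edge_pt (w i) (w (Suc i)) s"
    by (simp add: param_def i_def s_def)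
  have q: "param (a + real L / 2) = edge_pt (w j) (w (Suc j)) t"
    by (simp add: param_def j_def t_def)
  have ne: "w i \<noteq> w (Suc i)" "w j \<noteq> w (Suc j)" using arc_neq arc by auto
  \<comment> \<open>Isometry for walks of length 0: the vertices within one period are
    distinct.\<close>
  have neq: "w x \<noteq> w y" if "x < y" "y < x + L" for x y
    using isometric[of x y 0] that by auto
  have "w i \<noteq> w j" "w (Suc i) \<noteq> w j" "w i \<noteq> w (Suc j)" "w (Suc i) \<noteq> w (Suc j)"
    using neq[of i j] neq[of "Suc i" j] neq[of i "Suc j"] neq[of "Suc i" "Suc j"] less by auto
  then have "param a x = 0 \<or> param (a + real L / 2) x = 0" for x
    unfolding p q edge_pt_apply[OF ne(1)] edge_pt_apply[OF ne(2)] by auto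
  from path_length_disjoint_support[OF l this] obtain x y k where
    xyk: "0 < param a x" "0 < param (a + real L / 2) y" "(x, y) \<in> parcs G ^^ k"
    "(1 - param a x) + k + (1 - param (a + real L / 2) y) \<le> l" by blast
  have x: "(x = w i \<and> 1 - param a x = s) \<or> (x = w (Suc i) \<and> 1 - param a x = 1 - s)"
    using xyk(1) unfolding p edge_pt_apply[OF ne(1)] by (auto split: if_splits)
  have y: "(y = w j \<and> 1 - param (a + real L / 2) y = t) \<or>
      (y = w (Suc j) \<and> 1 - param (a + real L / 2) y = 1 - t)"
    using xyk(2) unfolding q edge_pt_apply[OF ne(2)] by (auto split: if_splits)
  have iso: "real n - real m \<le> real k \<or> real L \<le> real k + (real n - real m)"
    if "m \<le> n" "(w m, w n) \<in> parcs G ^^ k" for m n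
    using isometric[OF that] that(1) by linarith
  from x y show "real L / 2 \<le> l"
    using iso[of i j] iso[of "Suc i" j] iso[of i "Suc j"] iso[of "Suc i" "Suc j"] less xyk(3,4) ji st
    by (elim disjE conjE) (auto simp: field_simps)
qed

text \<open>The upper bounds on the three pieces between \<open>a\<close>, \<open>s\<close>,
  \<open>t\<close> and \<open>a + L / 2\<close> add up to the known antipodal distance, so each of
  them is sharp.\<close>

lemma gdist_param:
  assumes "0 \<le> a" "a \<le> s" "s \<le> t" "t \<le> a + real L / 2"
  shows "gdist G (param s) (param t) = t - s"
proof -
  have p: "param a \<in> points G" "param s \<in> points G" "param t \<in> points G"
    "param (a + real L / 2) \<in> points G"
    using assms by (auto intro: param_in_points)
  have "real L / 2 \<le> gdist G (param a) (param s) +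
      (gdist G (param s) (param t) + gdist G (param t) (param (a + real L / 2)))"
    using gdist_antipodal[OF assms(1)] gdist_triangle[OF p(1,2,4)] gdist_triangle[OF p(2,3,4)]
    by linarith
  then show ?thesis
    using gdist_param_le[of a s] gdist_param_le[of s t] gdist_param_le[of t "a + real L / 2"] assms
    by simp
qed

lemma is_geodesic_param:
  assumes "0 \<le> a"
  shows "is_geodesic G (param a) (param (a + real L / 2)) (param ` {a..a + real L / 2})"
proof -
  have d: "gdist G (param a) (param (a + real L / 2)) = real L / 2"
    using gdist_param[of a a "a + real L / 2"] assms by simp
  have "gdist G (param (a + s)) (param (a + t)) = \<bar>s - t\<bar>"
    if "s \<in> {0..real L / 2}" "t \<in> {0..real L / 2}" for s t
    using that assms gdist_param[of a "a + s" "a + t"] gdist_param[of a "a + t" "a + s"]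
      gdist_commute[of G "param (a + s)" "param (a + t)"]
    by (cases "s \<le> t") auto
  moreover have "param ` {a..a + real L / 2} = (\<lambda>s. param (a + s)) ` {0..real L / 2}"
    using image_add_atLeastAtMost[of a 0 "real L / 2"] by (metis add.commute add_0 image_image)
  moreover have "param ` {a..a + real L / 2} \<subseteq> points G"
    using assms by (auto intro: param_in_points)
  ultimately show ?thesis unfolding is_geodesic_def d
    by (intro exI[of _ "\<lambda>s. param (a + s)"]) auto
qed

text \<open>The third side is a single point. The midpoint of the first half is at distance
  \<open>L / 2\<close> from its antipode, and every point of the second half is within
  \<open>L / 4\<close> of that antipode, hence at least \<open>L / 4\<close> away from the
  midpoint.\<close>

lemma hyperbolicity_ge: "real L / 4 \<le> hyperbolicity G"
proof -
  let ?A = "param ` {0..real L / 2}" and ?B = "param ` {real L / 2..real L}" and ?C = "{param 0}"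
  have p0: "param 0 \<in> points G" "param (real L / 2) \<in> points G" by (auto intro: param_in_points)
  have "is_geodesic G (param 0) (param (real L / 2)) ?A" using is_geodesic_param[of 0] by simp
  moreover have "is_geodesic G (param (real L / 2)) (param 0) ?B"
    using is_geodesic_param[of "real L / 2"] param_periodic[of 0] by simp
  ultimately have T: "geodesic_triangle G ?A ?B ?C"
    unfolding geodesic_triangle_def using is_geodesic_self[OF p0(1)] p0 by blast
  have "real L / 4 \<le> gdist G (param (real L / 4)) q" if "q \<in> ?B \<union> ?C" for q
  proof -
    have "param 0 \<in> ?B" using param_periodic[of 0] by (intro image_eqI[of _ _ "real L"]) auto
    then obtain t where t: "q = param t" "real L / 2 \<le> t" "t \<le> real L" using \<open>q \<in> ?B \<union> ?C\<close> by auto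
    have "real L / 2 \<le> gdist G (param (real L / 4)) (param (3 * real L / 4))"
      using gdist_antipodal[of "real L / 4"] by (simp add: field_simps)
    also have "\<dots> \<le> gdist G (param (real L / 4)) q + gdist G q (param (3 * real L / 4))"
      using t by (intro gdist_triangle) (auto intro!: param_in_points)
    also have "gdist G q (param (3 * real L / 4)) \<le> \<bar>t - 3 * real L / 4\<bar>"
      unfolding t(1) using t by (intro gdist_param_le) auto
    also have "\<dots> \<le> real L / 4" using t by (simp add: abs_le_iff field_simps)
    finally show ?thesis by simp
  qed
  then have "real L / 4 \<le> triangle_delta G ?A ?B ?C"
    by (intro triangle_delta_geI[OF T, of "param (real L / 4)"]) auto
  then show ?thesis using triangle_delta_le_hyperbolicity[OF T] by simp
qed

end

section \<open>Isometric cycles from girth and parity\<close>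

context conn_graph
begin

text \<open>Reducing the index modulo \<open>k\<close> gives the periodic form that the locale
  \<open>isometric_cycle\<close> expects.\<close>

lemma cycle_arcs:
  assumes "k \<in> cycle_lengths G"
  obtains w where "3 \<le> k" "inj_on w {..<k}" "\<And>i. w (i + k) = w i" "\<And>i. (w i, w (Suc i)) \<in> parcs G"
proof -
  obtain v where v: "3 \<le> k" "inj_on v {..<k}" "v k = v 0" "\<forall>i<k. (v i, v (Suc i)) \<in> parcs G"
    using assms unfolding cycle_lengths_iff by blast
  show ?thesis
  proof
    show "3 \<le> k" by fact
    show "inj_on (\<lambda>i. v (i mod k)) {..<k}" using v(2) by (simp add: inj_on_def)
    show "v ((i + k) mod k) = v (i mod k)" for i by simp
    show "(v (i mod k), v (Suc i mod k)) \<in> parcs G" for i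
      using v(1,3) v(4)[rule_format, of "i mod k"] by (auto simp: mod_Suc)
  qed
qed

lemma walk_along:
  assumes "\<And>i. (w i, w (Suc i)) \<in> parcs G" "i \<le> j"
  shows "(w i, w j) \<in> parcs G ^^ (j - i)"
  using assms(2)
proof (induction rule: dec_induct)
  case (step n)
  then show ?case using assms(1)[of n] by (auto simp: Suc_diff_le)
qed auto

lemma closed_walk_3:
  assumes "(a, b) \<in> parcs G" "(b, c) \<in> parcs G" "(c, a) \<in> parcs G"
  shows "3 \<in> cycle_lengths G"
proof -
  define w where "w = (\<lambda>i :: nat. if i = 1 then b else if i = 2 then c else a)"
  have "inj_on w {..<3}"
    using assms arc_irrefl by (auto simp: inj_on_def w_def)
  moreover have "\<forall>i<3. (w i, w (Suc i)) \<in> parcs G"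
    using assms by (auto simp: w_def)
  ultimately show ?thesis unfolding cycle_lengths_iff using arc_verts(1)[OF assms(1)]
    by (intro conjI exI[of _ w]) (auto simp: w_def)
qed

lemma hyperbolicity_ge_1:
  assumes "girth G = enat 4"
  shows "1 \<le> hyperbolicity G"
proof -
  have 4: "4 \<in> cycle_lengths G" and 3: "3 \<notin> cycle_lengths G"
    using assms unfolding girth_eq_iff by auto
  obtain w where w: "inj_on w {..<4}" "\<And>i. w (i + 4) = w i" "\<And>i. (w i, w (Suc i)) \<in> parcs G"
    using cycle_arcs[OF 4] by metis
  interpret isometric_cycle G w 4
  proof
    fix i j k assume ij: "i \<le> j" "(w i, w j) \<in> parcs G ^^ k"
    have mod: "w m = w (m mod 4)" for m
    proof -
      have "w (m mod 4 + n * 4) = w (m mod 4)" for n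
        by (induction n) (use w(2) in \<open>auto simp: add.assoc[symmetric] add.commute[of 4]\<close>)
      from this[of "m div 4"] show ?thesis by simp
    qed
    have neq: "w i \<noteq> w (i + d)" if "0 < d" "d < 4" for d
    proof
      assume "w i = w (i + d)"
      then have "i mod 4 = (i + d) mod 4" using mod[of i] mod[of "i + d"] w(1) by (auto simp: inj_on_def)
      then show False using that by presburger
    qed
    show "j - i \<le> k \<or> 4 \<le> k + (j - i)"
    proof (rule ccontr)
      assume "\<not> ?thesis"
      \<comment> \<open>A shortcut on a 4-cycle can only identify two of its vertices or be a
        diagonal; a diagonal closes a triangle.\<close>
      then have "k = 0 \<and> j - i \<in> {1, 2, 3} \<or> k = 1 \<and> j - i = 2" by auto
      then show False
      proof
        assume "k = 0 \<and> j - i \<in> {1, 2, 3}"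
        then show False using neq[of "j - i"] ij by (cases "i < j") auto
      next
        assume *: "k = 1 \<and> j - i = 2"
        then have j: "j = Suc (Suc i)" by auto
        then have "(w j, w i) \<in> parcs G" using ij(2) * by (auto intro: arc_sym)
        then show False using closed_walk_3[OF w(3)[of i] w(3)[of "Suc i"]] 3 j by simp
      qed
    qed
  qed (use w in auto)
  show ?thesis using hyperbolicity_ge by simp
qed

text \<open>
  A shortest odd closed walk is isometrically embedded, because a shortcut forms an odd closed
  walk with the arc of opposite parity.
\<close>

lemma shortest_odd_isometric:
  assumes "(v, v) \<in> parcs G ^^ L" "odd L"
    and min: "\<And>u k. odd k \<Longrightarrow> (u, u) \<in> parcs G ^^ k \<Longrightarrow> L \<le> k"
    and "4 \<le> L"
  obtains w where "isometric_cycle G w L"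
proof -
  obtain f where f: "f 0 = v" "f L = v" "\<forall>i<L. (f i, f (Suc i)) \<in> parcs G"
    using assms(1) relpow_fun_conv by metis
  define w where "w = (\<lambda>i. f (i mod L))"
  have arc: "(w i, w (Suc i)) \<in> parcs G" for i
    using assms(4) f(1,2) f(3)[rule_format, of "i mod L"] by (auto simp: w_def mod_Suc)
  have per: "w (i + L) = w i" for i by (simp add: w_def)
  have "isometric_cycle G w L"
  proof
    fix i j k assume ij: "i \<le> j" "(w i, w j) \<in> parcs G ^^ k"
    show "j - i \<le> k \<or> L \<le> k + (j - i)"
    proof (cases "odd (k + (j - i))")
      case True
      have "(w i, w i) \<in> parcs G ^^ (k + (j - i))"
        using ij(2) walk_sym[OF walk_along[of w, OF arc ij(1)]] by (auto simp: relpow_add)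
      from min[OF True this] show ?thesis ..
    next
      case False
      show ?thesis
      proof (cases "j - i \<le> L")
        case True
        have "(w j, w (i + L)) \<in> parcs G ^^ (L - (j - i))"
          using walk_along[of w j "i + L", OF arc] True ij(1)
          by (simp add: diff_diff_right add.commute)
        then have "(w i, w i) \<in> parcs G ^^ (k + (L - (j - i)))"
          using ij(2) by (auto simp: relpow_add per)
        moreover have "odd (k + (L - (j - i)))" using False assms(2) True by auto
        ultimately have "L \<le> k + (L - (j - i))" using min by blast
        then show ?thesis using True by linarith
      qed auto
    qed
  qed (use arc per assms in auto)
  then show ?thesis using that by blast
qed

text \<open>The minimum is taken over closed walks rather than cycles, because a shortcut combined
  with an arc of the cycle may repeat vertices. Loops and triangles being absent, the minimal odd
  length is at least 5.\<close>

lemma odd_isometric_cycle: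
  assumes "3 \<notin> cycle_lengths G" "odd c" "c \<in> cycle_lengths G"
  obtains w L where "isometric_cycle G w L" "5 \<le> L"
proof -
  define P where "P k \<longleftrightarrow> odd k \<and> (\<exists>u. (u, u) \<in> parcs G ^^ k)" for k
  obtain f where f: "\<And>i. f (i + c) = f i" "\<And>i. (f i, f (Suc i)) \<in> parcs G"
    using cycle_arcs[OF assms(3)] by metis
  have "P c" using walk_along[of f 0 c] f(1)[of 0] f(2) assms(2) by (auto simp: P_def)
  define L where "L = Least P"
  have L: "P L" and min: "\<And>k. P k \<Longrightarrow> L \<le> k"
    unfolding L_def using \<open>P c\<close> by (auto intro: LeastI Least_le)
  obtain u where u: "(u, u) \<in> parcs G ^^ L" using L by (auto simp: P_def)
  have "L \<noteq> 1" using u arc_irrefl by auto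
  moreover have "L \<noteq> 3"
  proof
    assume "L = 3"
    then have "(u, u) \<in> parcs G ^^ Suc (Suc (Suc 0))" using u by (simp add: numeral_3_eq_3)
    then show False using closed_walk_3 assms(1) by auto
  qed
  moreover have "odd L" using L by (simp add: P_def)
  ultimately have L5: "5 \<le> L" by presburger
  obtain w where "isometric_cycle G w L"
    using shortest_odd_isometric[OF u \<open>odd L\<close>] min L5 by (auto simp: P_def)
  then show ?thesis using that L5 by blast
qed

lemma hyperbolicity_ge_5_4:
  assumes "girth G = enat 4" "odd c" "c \<in> cycle_lengths G"
  shows "5 / 4 \<le> hyperbolicity G"
proof -
  have "3 \<notin> cycle_lengths G" using assms(1) unfolding girth_eq_iff by auto
  then obtain w L where L: "isometric_cycle G w L" "5 \<le> L" using assms odd_isometric_cycle by metis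
  have "5 / 4 \<le> real L / 4" using L(2) by simp
  also have "\<dots> \<le> hyperbolicity G" by (rule isometric_cycle.hyperbolicity_ge[OF L(1)])
  finally show ?thesis .
qed

end

section \<open>Blow-ups\<close>

context conn_graph
begin

text \<open>The two routes through \<open>u\<close>, \<open>u'\<close> and through \<open>v\<close>, \<open>v'\<close> have total length \<open>2 + k + m\<close>.\<close>

lemma gdist_edge_pts_le:
  assumes "(u, v) \<in> parcs G" "(u', v') \<in> parcs G" "s \<in> {0..1}" "t \<in> {0..1}"
    and "(u, u') \<in> parcs G ^^ k" "(v, v') \<in> parcs G ^^ m"
  shows "gdist G (edge_pt u v s) (edge_pt u' v' t) \<le> 1 + (real k + real m) / 2"
proof -
  note verts = arc_verts[OF assms(1)]
  have u: "path_length G (edge_pt u v s) (vertex_pt u) s"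
    using path_length_segment[OF assms(1,3), of 0] assms(3) by simp
  have v: "path_length G (edge_pt u v s) (vertex_pt v) (1 - s)"
    using path_length_segment[OF assms(1,3), of 1] assms(3) by simp
  have u': "path_length G (vertex_pt u') (edge_pt u' v' t) t"
    using path_length_segment[OF assms(2) _ assms(4), of 0] assms(4) by simp
  have v': "path_length G (vertex_pt v') (edge_pt u' v' t) (1 - t)"
    using path_length_segment[OF assms(2) _ assms(4), of 1] assms(4) by simp
  show ?thesis
    using gdist_le[OF path_length_trans[OF u path_length_trans[OF path_length_walk[OF assms(5) verts(1)] u']]]
      gdist_le[OF path_length_trans[OF v path_length_trans[OF path_length_walk[OF assms(6) verts(2)] v']]]
    by argo
qed

text \<open>The bound is half of the diameter bound \<open>1 + N / 2\<close>. Positive degree puts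
  every point on an edge, so pairs of edges account for all pairs of points; the disjunction permits
  reversing the second edge.\<close>

lemma hyperbolicity_le_edges:
  assumes deg: "\<And>u. u \<in> pverts G \<Longrightarrow> \<exists>v. (u, v) \<in> parcs G"
    and near: "\<And>u v u' v'. (u, v) \<in> parcs G \<Longrightarrow> (u', v') \<in> parcs G \<Longrightarrow>
      \<exists>k m. k + m \<le> N \<and> ((u, u') \<in> parcs G ^^ k \<and> (v, v') \<in> parcs G ^^ m \<or>
        (u, v') \<in> parcs G ^^ k \<and> (v, u') \<in> parcs G ^^ m)"
  shows "hyperbolicity G \<le> (2 + real N) / 4"
proof -
  have edge: "\<exists>u v t. (u, v) \<in> parcs G \<and> t \<in> {0..1} \<and> p = edge_pt u v t" if "p \<in> points G" for p
    using that deg unfolding points_def by (force simp flip: edge_pt_0)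
  have "gdist G p q \<le> 1 + real N / 2" if "p \<in> points G" "q \<in> points G" for p q
  proof -
    obtain u v s where p: "(u, v) \<in> parcs G" "s \<in> {0..1}" "p = edge_pt u v s"
      using edge[OF \<open>p \<in> points G\<close>] by blast
    obtain u' v' t where q: "(u', v') \<in> parcs G" "t \<in> {0..1}" "q = edge_pt u' v' t"
      using edge[OF \<open>q \<in> points G\<close>] by blast
    obtain k m where km: "k + m \<le> N" "((u, u') \<in> parcs G ^^ k \<and> (v, v') \<in> parcs G ^^ m \<or>
        (u, v') \<in> parcs G ^^ k \<and> (v, u') \<in> parcs G ^^ m)"
      using near[OF p(1) q(1)] by blast
    have "gdist G p q \<le> 1 + (real k + real m) / 2"
      using gdist_edge_pts_le[OF p(1) q(1) p(2) q(2), of k m] km(2)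
        gdist_edge_pts_le[OF p(1) arc_sym[OF q(1)] p(2), of "1 - t" k m] p(3) q(2,3)
        edge_pt_swap[of u' v' t] by auto
    also have "real k + real m \<le> real N" using km(1) by linarith
    finally show ?thesis by simp
  qed
  from hyperbolicity_le[OF this] show ?thesis by (simp add: add_divide_distrib)
qed

end

text \<open>\<open>H\<close> is the adjacency relation of a pattern graph and \<open>f\<close> sends
  each vertex to its class. For irreflexive \<open>H\<close> the classes are independent
  sets.\<close>

definition blow_up :: "nat \<Rightarrow> (nat \<Rightarrow> nat) \<Rightarrow> nat rel \<Rightarrow> nat pair_pre_digraph" where
  "blow_up n f H = \<lparr>pverts = {..<n}, parcs = {(u, v). u < n \<and> v < n \<and> (f u, f v) \<in> H}\<rparr>"

lemma blow_up_simps [simp]: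
  "pverts (blow_up n f H) = {..<n}"
  "(u, v) \<in> parcs (blow_up n f H) \<longleftrightarrow> u < n \<and> v < n \<and> (f u, f v) \<in> H"
  by (auto simp: blow_up_def)

text \<open>Surjectivity of \<open>f\<close> onto the pattern lets walks of \<open>H\<close> lift.
  The diameter condition includes \<open>a = b\<close>: distinct vertices of one class are joined by
  a walk of length 2.\<close>

locale blow_up_graph =
  fixes n :: nat and f :: "nat \<Rightarrow> nat" and H :: "nat rel"
  assumes sym: "sym H" and irrefl: "irrefl H"
    and image: "f ` {..<n} = Field H" and pos: "0 < n"
    and diameter: "\<And>a b. a \<in> Field H \<Longrightarrow> b \<in> Field H \<Longrightarrow> (a, b) \<in> H \<union> H O H"
begin

abbreviation "G \<equiv> blow_up n f H"

lemma f_Field: "u < n \<Longrightarrow> f u \<in> Field H"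
  using image by auto

lemma walk_2: "u < n \<Longrightarrow> v < n \<Longrightarrow> (f u, f v) \<in> H O H \<Longrightarrow> (u, v) \<in> parcs G ^^ 2"
proof -
  assume *: "u < n" "v < n" "(f u, f v) \<in> H O H"
  then obtain b where b: "(f u, b) \<in> H" "(b, f v) \<in> H" by blast
  then have "b \<in> f ` {..<n}" unfolding image by (auto simp: Field_def)
  then obtain x where "x < n" "b = f x" by auto
  then have "(u, x) \<in> parcs G" "(x, v) \<in> parcs G" using * b by auto
  then show ?thesis by (auto simp: numeral_2_eq_2)
qed

lemma walk_1: "u < n \<Longrightarrow> v < n \<Longrightarrow> (f u, f v) \<in> H \<Longrightarrow> (u, v) \<in> parcs G ^^ 1"
  by simp

lemma pair_graph_blow_up: "pair_graph G"
proof
  show "symmetric (with_proj G)"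
    using sym unfolding symmetric_def with_proj_simps by (auto intro!: symI dest: symD)
  have "parcs G \<subseteq> {..<n} \<times> {..<n}" by auto
  then show "finite (parcs G)" by (rule finite_subset) auto
qed (use irrefl in \<open>auto simp: irrefl_def\<close>)

sublocale conn_graph G
proof
  interpret pair_graph G by (rule pair_graph_blow_up)
  have "\<exists>k. (u, v) \<in> parcs G ^^ k" if "u < n" "v < n" for u v
    using that walk_1[of u v] walk_2[of u v] diameter[OF f_Field f_Field, of u v] by blast
  then have "(u, v) \<in> (parcs G)\<^sup>*" if "u < n" "v < n" for u v
    using that by (simp add: rtrancl_power)
  then have "(u, v) \<in> ((parcs G)\<^sup>s)\<^sup>*" if "u < n" "v < n" for u v
    using that rtrancl_mono[of "parcs G" "(parcs G)\<^sup>s"] by (auto simp: symcl_def)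
  then have "(u, v) \<in> rtrancl_on {..<n} ((parcs G)\<^sup>s)" if "u < n" "v < n" for u v
    using that by (intro rtrancl_consistent_rtrancl_on) (auto simp: symcl_def)
  then have "Digraph_Component.connected (with_proj G)"
    using pos unfolding connected_conv by auto
  then show "fin_simple_connected G" using pair_graph_blow_up by (simp add: fin_simple_connected_def)
qed

lemma degree_pos: "u \<in> pverts G \<Longrightarrow> \<exists>v. (u, v) \<in> parcs G"
proof -
  assume u: "u \<in> pverts G"
  then have "f u \<in> Field H" by (simp add: f_Field)
  then obtain b where b: "(f u, b) \<in> H" using sym by (auto simp: Field_def dest: symD)
  then have "b \<in> f ` {..<n}" unfolding image by (auto simp: Field_def)
  then show ?thesis using b u by auto
qed

text \<open>Both pairs of matched ends are adjacent, so the connecting walks have total length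
  2.\<close>

lemma hyperbolicity_le_1:
  assumes "\<And>a b a' b'. (a, b) \<in> H \<Longrightarrow> (a', b') \<in> H \<Longrightarrow>
    (a, a') \<in> H \<and> (b, b') \<in> H \<or> (a, b') \<in> H \<and> (b, a') \<in> H"
  shows "hyperbolicity G \<le> 1"
proof -
  have "hyperbolicity G \<le> (2 + real 2) / 4"
  proof (rule hyperbolicity_le_edges[OF degree_pos])
    fix u v u' v' assume "(u, v) \<in> parcs G" "(u', v') \<in> parcs G"
    then show "\<exists>k m. k + m \<le> 2 \<and> ((u, u') \<in> parcs G ^^ k \<and> (v, v') \<in> parcs G ^^ m \<or>
        (u, v') \<in> parcs G ^^ k \<and> (v, u') \<in> parcs G ^^ m)"
      using assms[of "f u" "f v" "f u'" "f v'"] by (intro exI[of _ 1]) auto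
  qed
  then show ?thesis by simp
qed

text \<open>One pair of matched ends is adjacent and the other is joined by a walk of length at most
  2, giving total length 3.\<close>

lemma hyperbolicity_le_5_4:
  assumes "\<And>a b a' b'. (a, b) \<in> H \<Longrightarrow> (a', b') \<in> H \<Longrightarrow>
    (a, a') \<in> H \<or> (b, b') \<in> H \<or> (a, b') \<in> H \<or> (b, a') \<in> H"
  shows "hyperbolicity G \<le> 5 / 4"
proof -
  have "hyperbolicity G \<le> (2 + real 3) / 4"
  proof (rule hyperbolicity_le_edges[OF degree_pos])
    fix u v u' v' assume *: "(u, v) \<in> parcs G" "(u', v') \<in> parcs G"
    have le2: "\<exists>k\<le>2. (x, y) \<in> parcs G ^^ k" if "x < n" "y < n" for x y
      using that walk_1[of x y] walk_2[of x y] diameter[OF f_Field f_Field, of x y]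
      by (metis Un_iff one_le_numeral order_refl)
    have mix: "\<exists>k m. k + m \<le> 3 \<and> (x, y) \<in> parcs G ^^ k \<and> (z, z') \<in> parcs G ^^ m"
      "\<exists>k m. k + m \<le> 3 \<and> (z, z') \<in> parcs G ^^ k \<and> (x, y) \<in> parcs G ^^ m"
      if xy: "(x, y) \<in> parcs G" and z: "z < n" "z' < n" for x y z z'
    proof -
      obtain k where k: "k \<le> 2" "(z, z') \<in> parcs G ^^ k" using le2[OF z] by blast
      have e: "(x, y) \<in> parcs G ^^ 1" using xy by simp
      show "\<exists>k m. k + m \<le> 3 \<and> (x, y) \<in> parcs G ^^ k \<and> (z, z') \<in> parcs G ^^ m"
        using k e by (intro exI[of _ 1] exI[of _ k]) linarith
      show "\<exists>k m. k + m \<le> 3 \<and> (z, z') \<in> parcs G ^^ k \<and> (x, y) \<in> parcs G ^^ m"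
        using k e by (intro exI[of _ k] exI[of _ 1]) linarith
    qed
    have v: "u < n" "v < n" "u' < n" "v' < n" using * by auto
    then consider "(u, u') \<in> parcs G" | "(v, v') \<in> parcs G" | "(u, v') \<in> parcs G" | "(v, u') \<in> parcs G"
      using assms[of "f u" "f v" "f u'" "f v'"] * by auto
    then show "\<exists>k m. k + m \<le> 3 \<and> ((u, u') \<in> parcs G ^^ k \<and> (v, v') \<in> parcs G ^^ m \<or>
        (u, v') \<in> parcs G ^^ k \<and> (v, u') \<in> parcs G ^^ m)"
    proof cases
      case 1 show ?thesis using mix(1)[OF 1 v(2,4)] by blast
    next
      case 2 show ?thesis using mix(2)[OF 2 v(1,3)] by blast
    next
      case 3 show ?thesis using mix(1)[OF 3 v(2,3)] by blast
    next
      case 4 show ?thesis using mix(2)[OF 4 v(1,4)] by blast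
    qed
  qed
  then show ?thesis by simp
qed

lemma girth_eq_4:
  assumes "4 \<in> cycle_lengths G" "\<And>a b c. (a, b) \<in> H \<Longrightarrow> (b, c) \<in> H \<Longrightarrow> (c, a) \<notin> H"
  shows "girth G = enat 4"
proof -
  have "3 \<notin> cycle_lengths G"
  proof
    assume "3 \<in> cycle_lengths G"
    then obtain w where w: "\<And>i. w (i + 3) = w i" "\<And>i. (w i, w (Suc i)) \<in> parcs G"
      using cycle_arcs by metis
    have "w (Suc 2) = w 0" using w(1)[of 0] by simp
    then have "(f (w 0), f (w 1)) \<in> H" "(f (w 1), f (w 2)) \<in> H" "(f (w 2), f (w 0)) \<in> H"
      using w(2)[of 0] w(2)[of 1] w(2)[of 2] by (simp_all add: eval_nat_numeral)
    then show False using assms(2) by blast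
  qed
  then have "4 \<le> k" if "k \<in> cycle_lengths G" for k
    using that by (cases "k = 3") (auto simp: cycle_lengths_iff)
  then show ?thesis unfolding girth_eq_iff using assms(1) by blast
qed

end

section \<open>Vertex covers and the longest cycle\<close>

context conn_graph
begin

text \<open>Double counting: every edge of the cycle has an end in \<open>S\<close>, and every
  vertex of the cycle lies on two of its edges. Equality leaves no vertex of \<open>S\<close>
  unvisited and no edge counted twice.\<close>

lemma cycle_vertex_cover:
  fixes S :: "'a set"
  assumes w: "inj_on w {..<k}" "w k = w 0" "\<forall>i<k. (w i, w (Suc i)) \<in> parcs G"
    and S: "finite S" "\<And>u v. (u, v) \<in> parcs G \<Longrightarrow> u \<in> S \<or> v \<in> S"
  shows "k \<le> 2 * card S"
    and "k = 2 * card S \<Longrightarrow> S \<subseteq> w ` {..<k} \<and> (\<forall>i<k. \<not> (w i \<in> S \<and> w (Suc i) \<in> S))"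
proof -
  define m where "m i = (of_bool (w i \<in> S) :: nat)" for i
  define I where "I = {i. i < k \<and> w i \<in> S}"
  \<comment> \<open>Since \<open>w k = w 0\<close>, the end vertices of the arcs are the start
    vertices, shifted.\<close>
  have shift: "(\<Sum>i<k. m (Suc i)) = (\<Sum>i<k. m i)"
  proof (cases k)
    case (Suc k')
    have "m k = m 0" by (simp add: m_def w)
    then show ?thesis unfolding Suc sum.lessThan_Suc_shift[of m] sum.lessThan_Suc[of "\<lambda>i. m (Suc i)"]
      by (simp add: Suc)
  qed auto
  have ge1: "1 \<le> m i + m (Suc i)" if "i < k" for i
    using w(3) S(2) that by (auto simp: m_def)
  have I: "(\<Sum>i<k. m i) = card I"
    unfolding m_def I_def by (simp add: sum.If_cases of_bool_def lessThan_def Collect_conj_eq)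
  have total: "(\<Sum>i<k. m i + m (Suc i)) = 2 * card I"
    by (simp add: sum.distrib shift I)
  have "k = (\<Sum>i<k. 1)" by simp
  also have "\<dots> \<le> (\<Sum>i<k. m i + m (Suc i))" using ge1 by (intro sum_mono) auto
  finally have kI: "k \<le> 2 * card I" using total by simp
  have inj: "inj_on w I" by (rule inj_on_subset[OF w(1)]) (auto simp: I_def)
  have sub: "w ` I \<subseteq> S" by (auto simp: I_def)
  have "card I = card (w ` I)" using card_image[OF inj] by simp
  also have "\<dots> \<le> card S" using sub S(1) by (rule card_mono[rotated])
  finally have IS: "card I \<le> card S" .
  show "k \<le> 2 * card S" using kI IS by simp
  assume k: "k = 2 * card S"
  then have "card (w ` I) = card S" using kI IS card_image[OF inj] by simp
  then have "w ` I = S" using card_subset_eq[OF S(1) sub] by simp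
  moreover have "\<not> (w i \<in> S \<and> w (Suc i) \<in> S)" if "i < k" for i
  proof
    assume *: "w i \<in> S \<and> w (Suc i) \<in> S"
    have "(\<Sum>i<k. 1) < (\<Sum>i<k. m i + m (Suc i))"
      using ge1 that * by (intro sum_strict_mono_ex1) (auto simp: m_def intro!: bexI[of _ i])
    then show False using total k IS by simp
  qed
  ultimately show "S \<subseteq> w ` {..<k} \<and> (\<forall>i<k. \<not> (w i \<in> S \<and> w (Suc i) \<in> S))"
    by (auto simp: I_def)
qed

end

section \<open>Extremal graphs\<close>

definition bip :: "nat \<Rightarrow> nat \<Rightarrow> nat" where
  "bip m u = (if u < m then 0 else 1)"

lemma bipartite_extremal:
  assumes "2 \<le> m" "2 * m \<le> n"
  shows "\<exists>G\<in>graphs_gcn 4 (2 * m) n. hyperbolicity G = 1"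
proof -
  define H where "H = {(0 :: nat, 1 :: nat), (1, 0)}"
  interpret blow_up_graph n "bip m" H
  proof
    have "bip m ` {..<n} = {0, 1}"
    proof
      have "bip m 0 = 0" "bip m m = 1" "0 < n" "m < n" using assms by (auto simp: bip_def)
      then show "{0, 1} \<subseteq> bip m ` {..<n}" by force
    qed (auto simp: bip_def)
    then show "bip m ` {..<n} = Field H" by (auto simp: H_def Field_def)
    show "(a, b) \<in> H \<union> H O H" if "a \<in> Field H" "b \<in> Field H" for a b
      using that by (auto simp: H_def Field_def)
  qed (use assms in \<open>auto simp: sym_def irrefl_def H_def\<close>)
  have adj: "(u, v) \<in> parcs G \<longleftrightarrow> u < n \<and> v < n \<and> (u < m \<longleftrightarrow> \<not> v < m)" for u v
    by (auto simp: H_def bip_def)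
  have cyc: "2 * k \<in> cycle_lengths G" if "2 \<le> k" "k \<le> m" for k
  proof -
    \<comment> \<open>Even positions run through the first part and odd ones through the second; the
      first branch closes the cycle at 0. The values \<open>k = 2\<close> and \<open>k = m\<close>
      serve girth and circumference.\<close>
    define w where "w i = (if 2 * k \<le> i then 0 else if even i then i div 2 else m + i div 2)" for i
    have "inj_on w {..<2 * k}"
      using that by (auto simp: inj_on_def w_def elim!: evenE oddE split: if_splits)
    moreover have "\<forall>i<2 * k. (w i, w (Suc i)) \<in> parcs G"
      using that assms by (auto simp: w_def adj simp del: blow_up_simps elim!: evenE oddE)
    ultimately show ?thesis unfolding cycle_lengths_iff using that assms
      by (intro conjI exI[of _ w]) (auto simp: w_def)
  qed
  have "k \<le> 2 * m" if "k \<in> cycle_lengths G" for k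
  proof -
    obtain w where w: "inj_on w {..<k}" "w k = w 0" "\<forall>i<k. (w i, w (Suc i)) \<in> parcs G"
      using \<open>k \<in> cycle_lengths G\<close> unfolding cycle_lengths_iff by blast
    show ?thesis using cycle_vertex_cover(1)[OF w, of "{..<m}"] by (auto simp: adj simp del: blow_up_simps)
  qed
  then have circ: "circumference G = enat (2 * m)"
    using cyc[of m] assms by (intro circumference_eqI) auto
  have girth: "girth G = enat 4"
    using cyc[of 2] assms by (intro girth_eq_4) (auto simp: H_def)
  have "hyperbolicity G \<le> 1"
    by (rule hyperbolicity_le_1) (auto simp: H_def)
  then have "hyperbolicity G = 1" using hyperbolicity_ge_1[OF girth] by simp
  moreover have "G \<in> graphs_gcn 4 (2 * m) n"
    using girth circ fin_simple_connected by (simp add: graphs_gcn_def)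
  ultimately show ?thesis by blast
qed

text \<open>
  The pentagon with two adjacent vertices replaced by independent sets of sizes \<open>m\<close> and
  \<open>n - 3 - m\<close>.
\<close>

definition pent :: "nat \<Rightarrow> nat \<Rightarrow> nat \<Rightarrow> nat" where
  "pent m n u = (if u < m then 0 else if u < n - 3 then 1 else if u = n - 3 then 2
     else if u = n - 2 then 3 else 4)"

text \<open>The classes 0, 2 and 3 form a vertex cover of size \<open>m + 2\<close>. It bounds
  cycles by \<open>2 * m + 4\<close>, one too many, so the equality case of the cover bound has to
  be excluded.\<close>

lemma pentagon_extremal:
  assumes "1 \<le> m" "2 * m + 3 \<le> n" "6 \<le> n"
  shows "\<exists>G\<in>graphs_gcn 4 (2 * m + 3) n. hyperbolicity G = 5 / 4"
proof -
  define H where "H = {(0 :: nat, 1 :: nat), (1, 0), (1, 2), (2, 1), (2, 3), (3, 2), (3, 4), (4, 3), (4, 0), (0, 4)}"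
  have Field: "Field H = {0, 1, 2, 3, 4}" by (auto simp: H_def Field_def)
  interpret blow_up_graph n "pent m n" H
  proof
    have "pent m n ` {..<n} = {0, 1, 2, 3, 4}"
    proof
      have "pent m n 0 = 0" "pent m n m = 1" "pent m n (n - 3) = 2" "pent m n (n - 2) = 3"
        "pent m n (n - 1) = 4"
        using assms by (auto simp: pent_def)
      moreover have "0 < n" "m < n" "n - 3 < n" "n - 2 < n" "n - 1 < n" using assms by auto
      ultimately show "{0, 1, 2, 3, 4} \<subseteq> pent m n ` {..<n}"
        by (metis (no_types, lifting) image_eqI insert_subset lessThan_iff empty_subsetI)
    qed (auto simp: pent_def)
    then show "pent m n ` {..<n} = Field H" unfolding Field .
    show "(a, b) \<in> H \<union> H O H" if "a \<in> Field H" "b \<in> Field H" for a b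
    proof -
      have "\<forall>a\<in>Field H. \<forall>b\<in>Field H. (a, b) \<in> H \<or> (\<exists>c\<in>Field H. (a, c) \<in> H \<and> (c, b) \<in> H)"
        unfolding Field by (simp add: H_def)
      then show ?thesis using that by blast
    qed
  qed (use assms in \<open>auto simp: sym_def irrefl_def H_def\<close>)
  have adj: "(u, v) \<in> parcs G \<longleftrightarrow> u < n \<and> v < n \<and> (pent m n u, pent m n v) \<in> H" for u v
    by simp
  have "2 * m + 3 \<in> cycle_lengths G"
  proof -
    \<comment> \<open>A zigzag between \<open>m\<close> vertices each of classes 0 and 1 ends in
      class 1, and the remaining three vertices \<open>n - 3\<close>, \<open>n - 2\<close>,
      \<open>n - 1\<close> lead back to 0.\<close>
    define w where "w i = (if i < 2 * m then if even i then i div 2 else m + i div 2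
      else if i < 2 * m + 3 then n + i - (2 * m + 3) else 0)" for i
    have "inj_on w {..<2 * m + 3}"
      using assms by (auto simp: inj_on_def w_def elim!: evenE oddE split: if_splits)
    moreover have "(w i, w (Suc i)) \<in> parcs G" if i: "i < 2 * m + 3" for i
    proof -
      consider "i < 2 * m" "even i" | "Suc i < 2 * m" "odd i" | "Suc i = 2 * m" | "i = 2 * m"
        | "i = 2 * m + 1" | "i = 2 * m + 2"
        using i by fastforce
      then show ?thesis
      proof cases
        case 1
        then have "w i < m" "m \<le> w (Suc i)" "w (Suc i) < 2 * m" using assms by (auto simp: w_def elim!: evenE)
        then show ?thesis using assms by (auto simp: pent_def H_def)
      next
        case 2
        then have "m \<le> w i" "w i < 2 * m" "w (Suc i) < m" using assms by (auto simp: w_def elim!: oddE)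
        then show ?thesis using assms by (auto simp: pent_def H_def)
      next
        case 3
        then have "odd i" by presburger
        then have "m \<le> w i" "w i < 2 * m" "w (Suc i) = n - 3" using 3 assms by (auto simp: w_def elim!: oddE)
        then show ?thesis using assms by (auto simp: pent_def H_def)
      next
        case 4
        then have "w i = n - 3" "w (Suc i) = n - 2" using assms by (auto simp: w_def)
        then show ?thesis using assms by (auto simp: pent_def H_def)
      next
        case 5
        then have "w i = n - 2" "w (Suc i) = n - 1" using assms by (auto simp: w_def)
        then show ?thesis using assms by (auto simp: pent_def H_def)
      next
        case 6
        then have "w i = n - 1" "w (Suc i) = 0" using assms by (auto simp: w_def)
        then show ?thesis using assms by (auto simp: pent_def H_def)
      qed
    qed
    ultimately show ?thesis unfolding cycle_lengths_iff using assms
      by (intro conjI exI[of _ w]) (auto simp: w_def)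
  qed
  moreover have "k \<le> 2 * m + 3" if k: "k \<in> cycle_lengths G" for k
  proof -
    obtain w where w: "3 \<le> k" "inj_on w {..<k}" "w k = w 0" "\<forall>i<k. (w i, w (Suc i)) \<in> parcs G"
      using k unfolding cycle_lengths_iff by blast
    let ?S = "{..<m} \<union> {n - 3, n - 2}"
    have card: "card ?S = m + 2" using assms by (subst card_Un_disjoint) auto
    have cover: "u \<in> ?S \<or> v \<in> ?S" if "(u, v) \<in> parcs G" for u v
      using that assms by (auto simp: adj H_def pent_def split: if_splits)
    note vc = cycle_vertex_cover[OF w(2-4) _ cover, unfolded card]
    \<comment> \<open>With equality in the vertex cover bound, the cycle visits \<open>n - 2\<close> and both its neighbours there
      lie outside the cover, but \<open>n - 1\<close> is the only such neighbour.\<close>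
    have "k \<noteq> 2 * (m + 2)"
    proof
      assume "k = 2 * (m + 2)"
      then have S: "?S \<subseteq> w ` {..<k}" "\<And>i. i < k \<Longrightarrow> \<not> (w i \<in> ?S \<and> w (Suc i) \<in> ?S)"
        using vc(2) by blast+
      have nbr: "v = n - 1" if "(n - 2, v) \<in> parcs G \<or> (v, n - 2) \<in> parcs G" "v \<notin> ?S" for v
        using that assms by (auto simp: H_def pent_def split: if_splits)
      obtain i where i: "i < k" "w i = n - 2" using S(1) by auto
      have next_i: "w (Suc i) = n - 1" using nbr[of "w (Suc i)"] S(2)[OF i(1)] w(4) i by auto
      define j where "j = (if i = 0 then k - 1 else i - 1)"
      have j: "j < k" "w (Suc j) = n - 2" using i w(1,3) by (auto simp: j_def)
      have "w j = n - 1" using nbr[of "w j"] S(2)[OF j(1)] w(4) j by auto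
      moreover define i' where "i' = (if Suc i = k then 0 else Suc i)"
      have "i' < k" "w i' = n - 1" using i next_i w(3) by (auto simp: i'_def)
      ultimately have "i' = j" using w(2) j(1) by (simp add: inj_on_def)
      \<comment> \<open>The cyclic successor and predecessor of \<open>i\<close> coincide only on a
        cycle of length 2.\<close>
      then show False using w(1) i(1) by (auto simp: i'_def j_def split: if_splits)
    qed
    then show ?thesis using vc(1) by simp
  qed
  ultimately have circ: "circumference G = enat (2 * m + 3)" by (rule circumference_eqI)
  have "4 \<in> cycle_lengths G"
  proof -
    \<comment> \<open>The 4-cycle uses two vertices of class 1, namely \<open>m\<close> and
      \<open>m + 1\<close>; \<open>6 \<le> n\<close> guarantees the second one when
      \<open>m = 1\<close>.\<close>
    define w where "w i = (if i = 1 then m else if i = 2 then n - 3 else if i = 3 then m + 1 else 0)"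
      for i :: nat
    have "m + 1 < n - 3" using assms by auto
    have "inj_on w {..<4}"
      using \<open>m + 1 < n - 3\<close> assms by (auto simp: inj_on_def w_def split: if_splits)
    moreover have "(w i, w (Suc i)) \<in> parcs G" if "i < 4" for i
    proof -
      have "i \<in> {0, 1, 2, 3}" using that by auto
      then show ?thesis
        using \<open>m + 1 < n - 3\<close> assms by (elim insertE) (simp_all add: adj w_def pent_def H_def)
    qed
    ultimately show ?thesis unfolding cycle_lengths_iff using assms
      by (intro conjI exI[of _ w]) (auto simp: w_def)
  qed
  moreover have "\<forall>(a, b)\<in>H. \<forall>(b', c)\<in>H. b = b' \<longrightarrow> (c, a) \<notin> H" by (simp add: H_def)
  ultimately have girth: "girth G = enat 4" by (intro girth_eq_4) blast+
  \<comment> \<open>Two disjoint edges of a pentagon leave out one vertex only, so a third edge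
    joins them; the other pairs of edges share a vertex.\<close>
  have "\<forall>(a, b)\<in>H. \<forall>(a', b')\<in>H. (a, a') \<in> H \<or> (b, b') \<in> H \<or> (a, b') \<in> H \<or> (b, a') \<in> H"
    by (simp add: H_def)
  then have "hyperbolicity G \<le> 5 / 4" by (intro hyperbolicity_le_5_4) blast
  moreover have "5 / 4 \<le> hyperbolicity G"
    using hyperbolicity_ge_5_4[OF girth, of "2 * m + 3"] circumference_eqD[OF circ] by simp
  moreover have "G \<in> graphs_gcn 4 (2 * m + 3) n"
    using girth circ fin_simple_connected by (simp add: graphs_gcn_def)
  ultimately show ?thesis by force
qed

text \<open>Every chord of a pentagon cuts off a triangle, so without triangles the graph is the
  pentagon itself. A 4-cycle would then move by one step modulo 5 each time without turning back,
  for a total of 4 or -4, which is not 0 modulo 5.\<close>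

lemma (in conn_graph) no_4_cycle_in_pentagon:
  assumes "card (pverts G) = 5" "5 \<in> cycle_lengths G" "4 \<in> cycle_lengths G"
  shows "3 \<in> cycle_lengths G"
proof (rule ccontr)
  assume 3: "3 \<notin> cycle_lengths G"
  obtain w where w: "inj_on w {..<5}" "\<And>i. w (i + 5) = w i" "\<And>i. (w i, w (Suc i)) \<in> parcs G"
    using cycle_arcs[OF assms(2)] by metis
  have "w ` {..<5} \<subseteq> pverts G" using arc_verts(1)[OF w(3)] by auto
  then have img: "w ` {..<5} = pverts G"
    using card_image[OF w(1)] assms(1) by (intro card_subset_eq finite_verts) auto
  have chord: "(w i, w (i + 2)) \<notin> parcs G" for i
    using closed_walk_3[OF w(3)[of i] w(3)[of "Suc i"]] 3 arc_sym by (auto simp: numeral_2_eq_2)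
  have five: "w 5 = w 0" "w 6 = w 1" using w(2)[of 0] w(2)[of 1] by (auto simp: numeral_eq_Suc)
  have nbr: "b = (a + 1) mod 5 \<or> a = (b + 1) mod 5"
    if "(w a, w b) \<in> parcs G" "a < 5" "b < 5" for a b
  proof -
    have c: "(w 0, w 2) \<notin> parcs G" "(w 1, w 3) \<notin> parcs G" "(w 2, w 4) \<notin> parcs G"
      "(w 3, w 0) \<notin> parcs G" "(w 4, w 1) \<notin> parcs G"
      using chord[of 0] chord[of 1] chord[of 2] chord[of 3] chord[of 4] five by (auto simp: numeral_eq_Suc)
    have c': "(w 2, w 0) \<notin> parcs G" "(w 3, w 1) \<notin> parcs G" "(w 4, w 2) \<notin> parcs G"
      "(w 0, w 3) \<notin> parcs G" "(w 1, w 4) \<notin> parcs G" using c arc_sym by blast+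
    have "a \<in> {0, 1, 2, 3, 4}" "b \<in> {0, 1, 2, 3, 4}" using that by auto
    then show ?thesis using that(1) c c' arc_irrefl by auto
  qed
  obtain v where v: "inj_on v {..<4}" "\<And>i. v (i + 4) = v i" "\<And>i. (v i, v (Suc i)) \<in> parcs G"
    using cycle_arcs[OF assms(3)] by metis
  have "v i \<in> w ` {..<5}" for i unfolding img using arc_verts(1)[OF v(3)] .
  then have "\<exists>a. \<forall>i. a i < 5 \<and> v i = w (a i)" by (intro choice) auto
  then obtain a where a: "\<And>i. a i < 5" "\<And>i. v i = w (a i)" by blast
  have step: "a (i + 1) = (a i + 1) mod 5 \<or> a i = (a (i + 1) + 1) mod 5" for i
    using nbr[of "a i" "a (i + 1)"] v(3)[of i] a by simp
  have "v 4 = v 0" using v(2)[of 0] by simp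
  then have "a 4 = a 0" using a(1) w(1) unfolding a(2) by (simp add: inj_on_def)
  \<comment> \<open>Vertices two apart on the 4-cycle differ, so the index sequence \<open>a\<close>
    never backtracks.\<close>
  moreover have "v 0 \<noteq> v 2" "v 1 \<noteq> v 3" using inj_onD[OF v(1), of 0 2] inj_onD[OF v(1), of 1 3] by auto
  then have "a 0 \<noteq> a 2" "a 1 \<noteq> a 3" unfolding a(2) by auto
  ultimately have ne: "a 2 \<noteq> a 0" "a 3 \<noteq> a 1" "a 4 \<noteq> a 2" and closed: "a 4 = a 0" by auto
  have st: "a 1 = (a 0 + 1) mod 5 \<or> a 0 = (a 1 + 1) mod 5" "a 2 = (a 1 + 1) mod 5 \<or> a 1 = (a 2 + 1) mod 5"
    "a 3 = (a 2 + 1) mod 5 \<or> a 2 = (a 3 + 1) mod 5" "a 4 = (a 3 + 1) mod 5 \<or> a 3 = (a 4 + 1) mod 5"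
    using step[of 0] step[of 1, unfolded one_add_one] step[of 2] step[of 3] by simp_all
  have inj: "x = y" if "(x + 1) mod 5 = (y + 1) mod 5" "x < 5" "y < 5" for x y :: nat
    using that by (auto simp: mod_Suc split: if_splits)
  have a0: "a 0 \<in> {0, 1, 2, 3, 4}" using a(1)[of 0] by auto
  from st(1) show False
  proof
    assume 1: "a 1 = (a 0 + 1) mod 5"
    then have 2: "a 2 = (a 1 + 1) mod 5" using st(2) ne(1) inj[OF _ a(1) a(1)] by metis
    then have 3: "a 3 = (a 2 + 1) mod 5" using st(3) ne(2) inj[OF _ a(1) a(1)] by metis
    then have 4: "a 4 = (a 3 + 1) mod 5" using st(4) ne(3) inj[OF _ a(1) a(1)] by metis
    show False using a0 1 2 3 4 closed by auto
  next
    assume 1: "a 0 = (a 1 + 1) mod 5"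
    then have 2: "a 1 = (a 2 + 1) mod 5" using st(2) ne(1) by metis
    then have 3: "a 2 = (a 3 + 1) mod 5" using st(3) ne(2) by metis
    then have 4: "a 3 = (a 4 + 1) mod 5" using st(4) ne(3) by metis
    show False using a0 1 2 3 4 closed by auto
  qed
qed

lemma min_hyperbolicity_eqI:
  assumes "\<exists>G\<in>graphs_gcn g c n. hyperbolicity G = r"
    and "\<And>G. G \<in> graphs_gcn g c n \<Longrightarrow> r \<le> hyperbolicity G"
  shows "min_hyperbolicity g c n = r"
  unfolding min_hyperbolicity_def using assms by (intro Least_equality) auto

theorem theorem3p8:
  fixes c n :: nat
  assumes "4 \<le> c" and "c \<le> n"
    and "v_admissible 4 c n"
  shows "(even c \<longrightarrow> min_hyperbolicity 4 c n = 1) \<and>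
         (odd c \<longrightarrow> min_hyperbolicity 4 c n = 5 / 4)"
proof (intro conjI impI)
  assume "even c"
  then obtain m where m: "c = 2 * m" by (rule evenE)
  have "1 \<le> hyperbolicity G" if "G \<in> graphs_gcn 4 c n" for G
    using that conn_graph.hyperbolicity_ge_1[of G] by (simp add: graphs_gcn_def conn_graph_def)
  then show "min_hyperbolicity 4 c n = 1"
    using bipartite_extremal[of m n] assms m by (intro min_hyperbolicity_eqI) auto
next
  assume "odd c"
  then obtain m where "c = 2 * m + 1" by (rule oddE)
  then have m: "c = 2 * (m - 1) + 3" "2 \<le> m" using assms(1) by auto
  have *: "conn_graph G" "girth G = enat 4" "c \<in> cycle_lengths G" "card (pverts G) = n"
    if "G \<in> graphs_gcn 4 c n" for G
    using that assms(1) circumference_eqD[of G c] by (auto simp: graphs_gcn_def conn_graph_def)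
  \<comment> \<open>An odd \<open>c \<ge> 4\<close> is at least 5, so \<open>n = 5\<close> forces
    \<open>c = 5\<close>; this is where v-admissibility supplies \<open>6 \<le> n\<close> for the
    construction.\<close>
  have "n \<noteq> 5"
  proof
    assume "n = 5"
    then have c: "c = 5" using assms(1,2) m by presburger
    obtain G where "G \<in> graphs_gcn 4 c n" using assms(3) by (auto simp: v_admissible_def)
    note G = *[OF this]
    have "4 \<in> cycle_lengths G" "3 \<notin> cycle_lengths G" using G(2) unfolding girth_eq_iff by auto
    then show False using conn_graph.no_4_cycle_in_pentagon[OF G(1)] G c \<open>n = 5\<close> by auto
  qed
  then have "\<exists>G\<in>graphs_gcn 4 c n. hyperbolicity G = 5 / 4"
    using pentagon_extremal[of "m - 1" n] m assms(2) by auto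
  moreover have "5 / 4 \<le> hyperbolicity G" if "G \<in> graphs_gcn 4 c n" for G
    using conn_graph.hyperbolicity_ge_5_4[OF *(1,2)] *(3) that \<open>odd c\<close> by blast
  ultimately show "min_hyperbolicity 4 c n = 5 / 4" by (rule min_hyperbolicity_eqI)
qed

end
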